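(* For $i\in\{1,2\}$, $s_i(n,\# P_4,P_5)=(3+o(1))n$ as $n\to\infty$.
   Context: For graphs $F$ and $H$, the $F$-saturation game on $n$ vertices is played by Max and Mini, who alternately claim previously unclaimed edges of $K_n$ so that the graph $G$ of claimed edges stays $F$-free; the game ends when $G$ is $F$-saturated. The $H$-score is the number of (not necessarily induced) subgraphs of the final $G$ isomorphic to $H$. Max maximizes, Mini minimizes the score; $s_1(n,\# H,F)$ is the optimal score when Max starts, $s_2(n,\# H,F)$ when Mini starts. $P_k$ denotes the path on $k$ vertices. *)

theory Defs
  imports Complex_Main "HOL-Library.Ramsey" "HOL-Library.Landau_Symbols"
begin

text \<open>A simple graph is a pair of its vertex set and its set of edges, where an edge is a
  two-element set of vertices.\<close>

type_synonym 'a graph = "'a set \<times> 'a set set"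

definition is_graph :: "'a graph \<Rightarrow> bool" where
  "is_graph G \<longleftrightarrow> snd G \<subseteq> [fst G]\<^bsup>2\<^esup>"

definition subgraph_of :: "'a graph \<Rightarrow> 'a graph \<Rightarrow> bool" where
  "subgraph_of S G \<longleftrightarrow> is_graph S \<and> fst S \<subseteq> fst G \<and> snd S \<subseteq> snd G"

definition graph_isomorphic :: "'a graph \<Rightarrow> 'b graph \<Rightarrow> bool" where
  "graph_isomorphic G H \<longleftrightarrow>
     (\<exists>f. bij_betw f (fst G) (fst H) \<and>
       (\<forall>u\<in>fst G. \<forall>v\<in>fst G. {u, v} \<in> snd G \<longleftrightarrow> {f u, f v} \<in> snd H))"

definition copies :: "'b graph \<Rightarrow> 'a graph \<Rightarrow> 'a graph set" where
  "copies H G = {S. subgraph_of S G \<and> graph_isomorphic S H}"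

definition free_of :: "'b graph \<Rightarrow> 'a graph \<Rightarrow> bool" where
  "free_of F G \<longleftrightarrow> copies F G = {}"

definition saturated :: "'b graph \<Rightarrow> 'a graph \<Rightarrow> bool" where
  "saturated F G \<longleftrightarrow> free_of F G \<and>
     (\<forall>e\<in>[fst G]\<^bsup>2\<^esup> - snd G. \<not> free_of F (fst G, insert e (snd G)))"

definition path_graph :: "nat \<Rightarrow> nat graph" where
  "path_graph k = ({..<k}, {{i, Suc i} | i. Suc i < k})"

text \<open>The board is the complete graph on \<open>{..<n}\<close>; a position is the set of claimed edges
  together with the player to move.\<close>

datatype player = MaxP | MiniP

definition legal_moves :: "'b graph \<Rightarrow> nat \<Rightarrow> nat set set \<Rightarrow> nat set set" where
  "legal_moves F n E = {e \<in> [{..<n}]\<^bsup>2\<^esup> - E. free_of F ({..<n}, insert e E)}"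

lemma saturated_iff_no_legal_moves:
  "saturated F ({..<n}, E) \<longleftrightarrow> free_of F ({..<n}, E) \<and> legal_moves F n E = {}"
  by (auto simp: saturated_def legal_moves_def)

text \<open>The score under optimal play from a given position, by backward induction. Positions
  reachable from an \<open>F\<close>-free one are \<open>F\<close>-free, so by the preceding lemma the first branch is
  taken exactly when the claimed graph is saturated.\<close>

function game_value :: "'c graph \<Rightarrow> 'b graph \<Rightarrow> nat \<Rightarrow> player \<Rightarrow> nat set set \<Rightarrow> nat" where
  "game_value H F n p E =
     (if legal_moves F n E = {} then card (copies H ({..<n}, E))
      else case p of
        MaxP \<Rightarrow> Max ((\<lambda>e. game_value H F n MiniP (insert e E)) ` legal_moves F n E)
      | MiniP \<Rightarrow> Min ((\<lambda>e. game_value H F n MaxP (insert e E)) ` legal_moves F n E))"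
  by pat_completeness auto
termination
proof (relation "measure (\<lambda>(H, F, n, p, E). card ([{..<n}]\<^bsup>2\<^esup> - E))", goal_cases)
  case 1
  show ?case by simp
next
  have *: "card ([{..<n}]\<^bsup>2\<^esup> - insert e E) < card ([{..<n}]\<^bsup>2\<^esup> - E)"
    if "e \<in> legal_moves F n E" for e E n and F :: "'b graph"
    using that by (intro psubset_card_mono) (auto simp: legal_moves_def finite_imp_finite_nsets)
  {
    case 2
    then show ?case using * by simp
  next
    case 3
    then show ?case using * by simp
  }
qed

declare game_value.simps [simp del]

definition s1 :: "nat \<Rightarrow> 'c graph \<Rightarrow> 'b graph \<Rightarrow> nat" where
  "s1 n H F = game_value H F n MaxP {}"

definition s2 :: "nat \<Rightarrow> 'c graph \<Rightarrow> 'b graph \<Rightarrow> nat" where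
  "s2 n H F = game_value H F n MiniP {}"

end

theory Submission
  imports Defs
begin

text \<open>
  Every component of a \<open>P\<^sub>5\<close>-saturated graph is, up to one exception on at most two vertices, a
  triangle, a \<open>K\<^sub>4\<close>, a triangle with pendant edges at one vertex, or a double star; a \<open>K\<^sub>4\<close> has 12
  copies of \<open>P\<^sub>4\<close>, that is three per vertex, and only double stars can have more.

  Mini keeps every vertex of degree at least two on a triangle or a 4-cycle, by closing each path
  that Max creates and otherwise claiming isolated edges. This excludes double stars with two
  leaves at both centers, and without these there are at most three copies of \<open>P\<^sub>4\<close> per vertex.

  Max keeps a perfect matching on the non-isolated vertices, with every component on at most four
  vertices and none a triangle with a pendant edge. Mini can only spoil this by building a double
  star; if \<open>C \<surd>n\<close> isolated vertices are left, Max then adds leaves to it on both sides until it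
  contains \<open>3 n\<close> copies of \<open>P\<^sub>4\<close> on its own. Once fewer isolated vertices are left, the rest of the
  game does not matter: each of them affects at most four matched vertices, and all other components
  (but one edge) end up as \<open>K\<^sub>4\<close>.
\<close>

text \<open>The triangle with pendant edges at one vertex is what Max has to avoid. With m pendant
  edges it has only 2 m copies of P_4 on m + 3 vertices, and from m = 2 on such a component can
  change only by further pendant edges at the same vertex. A triangle with one pendant edge would
  let Mini start this, so Max never leaves one behind. In the positions that Max does leave, a new
  vertex can be attached only to an isolated vertex, to an isolated edge or to an inner vertex of a
  path on four vertices, and each of these has an answer. The number of copies in a double star is
  the product of its two leaf counts, so order sqrt n leaves on each side give 3 n copies. The
  isolated vertices held in reserve for this cost only order sqrt n copies if no double star ever
  appears. Mini's difficulty is the end of the game: without two isolated vertices there may be no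
  waiting move, and a forced move can put a vertex of degree two off the cycles. By then the
  position is \<open>nearly_settled\<close>, which excludes double stars however the game
  continues.\<close>

section \<open>Paths and their copies\<close>

definition p5free :: "'a set set \<Rightarrow> bool" where
  "p5free E \<longleftrightarrow> (\<nexists>a b c d e. distinct [a, b, c, d, e] \<and> {a, b} \<in> E \<and> {b, c} \<in> E \<and> {c, d} \<in> E \<and> {d, e} \<in> E)"

lemma p5freeD:
  assumes "p5free E" "{a, b} \<in> E" "{b, c} \<in> E" "{c, d} \<in> E" "{d, e} \<in> E" "distinct [a, b, c, d, e]"
  shows False
  using assms unfolding p5free_def by blast

definition path_lists :: "nat \<Rightarrow> 'a set \<Rightarrow> 'a set set \<Rightarrow> 'a list set" where
  "path_lists k V E = {xs. length xs = k \<and> distinct xs \<and> set xs \<subseteq> V \<and>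
     (\<forall>i. Suc i < k \<longrightarrow> {xs ! i, xs ! Suc i} \<in> E)}"

definition graph_of_list :: "'a list \<Rightarrow> 'a graph" where
  "graph_of_list xs = (set xs, {{xs ! i, xs ! Suc i} | i. Suc i < length xs})"

text \<open>Reading an isomorphism backwards lists the vertices of a copy in path order. From here
  on copies are handled through such lists.\<close>

lemma copies_path_graph:
  "copies (path_graph k) (V, E) = graph_of_list ` path_lists k V E"
proof (intro equalityI subsetI)
  fix S assume "S \<in> copies (path_graph k) (V, E)"
  then obtain f where S: "is_graph S" "fst S \<subseteq> V" "snd S \<subseteq> E" and f: "bij_betw f (fst S) {..<k}"
    and iso: "\<And>u v. u \<in> fst S \<Longrightarrow> v \<in> fst S \<Longrightarrow>
      {u, v} \<in> snd S \<longleftrightarrow> {f u, f v} \<in> {{i, Suc i} | i. Suc i < k}"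
    unfolding copies_def subgraph_of_def graph_isomorphic_def path_graph_def by auto
  define g where "g = inv_into (fst S) f"
  have g: "bij_betw g {..<k} (fst S)" unfolding g_def using f by (rule bij_betw_inv_into)
  have fg: "f (g i) = i" if "i < k" for i
    using that f unfolding g_def by (simp add: bij_betw_inv_into_right)
  have gf: "g (f u) = u" if "u \<in> fst S" for u
    using that f unfolding g_def by (simp add: bij_betw_inv_into_left)
  have gS: "g i \<in> fst S" if "i < k" for i using that g by (auto simp: bij_betw_def)
  define xs where "xs = map g [0..<k]"
  have edge: "{g i, g (Suc i)} \<in> snd S" if "Suc i < k" for i
    using that by (subst iso) (auto simp: gS fg)
  have "set xs = fst S" using g by (auto simp: xs_def bij_betw_def lessThan_atLeast0)
  moreover have "snd S = {{xs ! i, xs ! Suc i} | i. Suc i < length xs}"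
  proof (intro equalityI subsetI)
    fix e assume e: "e \<in> snd S"
    then obtain u v where uv: "e = {u, v}" "u \<in> fst S" "v \<in> fst S"
      using S(1) unfolding is_graph_def nsets_def by (fastforce simp: card_2_iff)
    then obtain i where i: "{f u, f v} = {i, Suc i}" "Suc i < k" using iso e by blast
    then have "e = {g i, g (Suc i)}"
      using gf uv by (metis image_empty image_insert)
    then show "e \<in> {{xs ! i, xs ! Suc i} | i. Suc i < length xs}"
      using i(2) by (auto simp: xs_def intro!: exI[of _ i])
  qed (use edge in \<open>auto simp: xs_def\<close>)
  ultimately have "S = graph_of_list xs" by (simp add: graph_of_list_def prod_eq_iff)
  moreover have "xs \<in> path_lists k V E"
    using S edge gS g unfolding path_lists_def
    by (auto simp: xs_def distinct_map bij_betw_def lessThan_atLeast0)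
  ultimately show "S \<in> graph_of_list ` path_lists k V E" by blast
next
  fix S assume "S \<in> graph_of_list ` path_lists k V E"
  then obtain xs where S: "S = graph_of_list xs" and xs: "length xs = k" "distinct xs" "set xs \<subseteq> V"
    "\<And>i. Suc i < k \<Longrightarrow> {xs ! i, xs ! Suc i} \<in> E"
    unfolding path_lists_def by auto
  have bij: "bij_betw ((!) xs) {..<k} (set xs)" using xs by (simp add: bij_betw_nth)
  define f where "f = inv_into {..<k} ((!) xs)"
  have f: "bij_betw f (set xs) {..<k}" unfolding f_def using bij by (rule bij_betw_inv_into)
  have fx: "f (xs ! i) = i" if "i < k" for i
    using that bij unfolding f_def by (simp add: bij_betw_inv_into_left)
  have "subgraph_of S (V, E)"
    using xs by (auto simp: S subgraph_of_def graph_of_list_def is_graph_def nsets_def nth_eq_iff_index_eq)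
  moreover have "graph_isomorphic S (path_graph k)"
    unfolding graph_isomorphic_def
  proof (intro exI conjI ballI)
    show "bij_betw f (fst S) (fst (path_graph k))" using f by (simp add: S graph_of_list_def path_graph_def)
    fix u v assume "u \<in> fst S" "v \<in> fst S"
    then obtain i j where ij: "u = xs ! i" "v = xs ! j" "i < k" "j < k"
      using xs(1) by (auto simp: S graph_of_list_def in_set_conv_nth)
    show "{u, v} \<in> snd S \<longleftrightarrow> {f u, f v} \<in> snd (path_graph k)"
      using ij xs(1,2) by (auto simp: S graph_of_list_def path_graph_def fx doubleton_eq_iff nth_eq_iff_index_eq)
  qed
  ultimately show "S \<in> copies (path_graph k) (V, E)" by (simp add: copies_def)
qed

lemma path_lists_4:
  "path_lists 4 V E = {[a, b, c, d] | a b c d. distinct [a, b, c, d] \<and> {a, b, c, d} \<subseteq> V \<and>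
     {a, b} \<in> E \<and> {b, c} \<in> E \<and> {c, d} \<in> E}"
proof -
  have "(\<forall>i. Suc i < 4 \<longrightarrow> P i) \<longleftrightarrow> P 0 \<and> P 1 \<and> P 2" for P :: "nat \<Rightarrow> bool"
    by (auto simp: numeral_eq_Suc less_Suc_eq)
  note steps = this[of "\<lambda>i. {xs ! i, xs ! Suc i} \<in> E" for xs]
  have len: "length xs = 4 \<longleftrightarrow> (\<exists>a b c d. xs = [a, b, c, d])" for xs :: "'a list"
    by (auto simp: numeral_eq_Suc length_Suc_conv)
  show ?thesis
    unfolding path_lists_def steps len by (auto simp: numeral_eq_Suc)
qed

lemma path_lists_5:
  "path_lists 5 V E = {[a, b, c, d, e] | a b c d e. distinct [a, b, c, d, e] \<and> {a, b, c, d, e} \<subseteq> V \<and>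
     {a, b} \<in> E \<and> {b, c} \<in> E \<and> {c, d} \<in> E \<and> {d, e} \<in> E}"
proof -
  have "(\<forall>i. Suc i < 5 \<longrightarrow> P i) \<longleftrightarrow> P 0 \<and> P 1 \<and> P 2 \<and> P 3" for P :: "nat \<Rightarrow> bool"
    by (auto simp: numeral_eq_Suc less_Suc_eq)
  note steps = this[of "\<lambda>i. {xs ! i, xs ! Suc i} \<in> E" for xs]
  have len: "length xs = 5 \<longleftrightarrow> (\<exists>a b c d e. xs = [a, b, c, d, e])" for xs :: "'a list"
    by (auto simp: numeral_eq_Suc length_Suc_conv)
  show ?thesis
    unfolding path_lists_def steps len by (auto simp: numeral_eq_Suc)
qed

lemma free_of_path_graph_5:
  assumes "E \<subseteq> [V]\<^bsup>2\<^esup>"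
  shows "free_of (path_graph 5) (V, E) \<longleftrightarrow> p5free E"
proof -
  have sub: "a \<in> V \<and> b \<in> V" if "{a, b} \<in> E" for a b using that assms by (auto simp: nsets_def)
  have "path_lists 5 V E = {}" if "p5free E"
    using that p5freeD[of E] unfolding path_lists_5 by blast
  moreover have "p5free E" if "path_lists 5 V E = {}"
    unfolding p5free_def
  proof (rule notI, elim exE conjE)
    fix a b c d e
    assume p: "distinct [a, b, c, d, e]" "{a, b} \<in> E" "{b, c} \<in> E" "{c, d} \<in> E" "{d, e} \<in> E"
    then have "{a, b, c, d, e} \<subseteq> V" using sub[OF p(2)] sub[OF p(3)] sub[OF p(5)] by simp
    then have "[a, b, c, d, e] \<in> path_lists 5 V E" unfolding path_lists_5 using p by blast
    then show False using that by simp
  qed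
  ultimately show ?thesis by (auto simp: free_of_def copies_path_graph)
qed

lemma finite_path_lists: "finite V \<Longrightarrow> finite (path_lists k V E)"
  by (rule finite_subset[OF _ finite_lists_length_eq[of V k]]) (auto simp: path_lists_def)

lemma graph_of_list_4: "graph_of_list [a, b, c, d] = ({a, b, c, d}, {{a, b}, {b, c}, {c, d}})"
proof -
  have "{f i | i. Suc i < 4} = {f 0, f 1, f 2}" for f :: "nat \<Rightarrow> 'a set"
    by (auto simp: numeral_eq_Suc less_Suc_eq)
  from this[of "\<lambda>i. {[a, b, c, d] ! i, [a, b, c, d] ! Suc i}"] show ?thesis
    by (simp add: graph_of_list_def numeral_eq_Suc)
qed

text \<open>The middle edge is the only one that meets both others, so the edge set fixes the list
  up to reversal. Hence the factor 2 between lists and copies below.\<close>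

lemma graph_of_list_4_eq_iff:
  assumes "distinct [a, b, c, d]" "distinct [a', b', c', d']"
  shows "graph_of_list [a', b', c', d'] = graph_of_list [a, b, c, d] \<longleftrightarrow>
    [a', b', c', d'] = [a, b, c, d] \<or> [a', b', c', d'] = [d, c, b, a]"
proof
  assume "graph_of_list [a', b', c', d'] = graph_of_list [a, b, c, d]"
  then have e: "{{a', b'}, {b', c'}, {c', d'}} = {{a, b}, {b, c}, {c, d}}"
    by (simp add: graph_of_list_4)
  have "{a', b'} \<in> {{a, b}, {b, c}, {c, d}}" "{b', c'} \<in> {{a, b}, {b, c}, {c, d}}"
     "{c', d'} \<in> {{a, b}, {b, c}, {c, d}}"
    unfolding e[symmetric] by simp_all
  moreover have "{b, c} \<in> {{a', b'}, {b', c'}, {c', d'}}" unfolding e by simp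
  ultimately show "[a', b', c', d'] = [a, b, c, d] \<or> [a', b', c', d'] = [d, c, b, a]"
    using assms by (auto simp: doubleton_eq_iff)
qed (auto simp: graph_of_list_4)

lemma card_path_lists_4:
  assumes "finite V"
  shows "card (path_lists 4 V E) = 2 * card (copies (path_graph 4) (V, E))"
proof -
  let ?T = "path_lists 4 V E"
  have fib: "card {ys \<in> ?T. graph_of_list ys = S} = 2" if "S \<in> graph_of_list ` ?T" for S
  proof -
    from that obtain xs where xs: "xs \<in> ?T" "S = graph_of_list xs" by blast
    then obtain a b c d where "xs = [a, b, c, d]" "distinct [a, b, c, d]"
      unfolding path_lists_4 by blast
    with xs have abcd: "[a, b, c, d] \<in> ?T" "S = graph_of_list [a, b, c, d]" "distinct [a, b, c, d]"
      by simp_all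
    then have "[d, c, b, a] \<in> ?T" unfolding path_lists_4 by (auto simp: insert_commute)
    then have "{ys \<in> ?T. graph_of_list ys = S} = {[a, b, c, d], [d, c, b, a]}"
    proof (intro equalityI subsetI)
      fix ys assume "ys \<in> {ys \<in> ?T. graph_of_list ys = S}"
      then obtain a' b' c' d' where "ys = [a', b', c', d']" "distinct [a', b', c', d']" "graph_of_list ys = S"
        unfolding path_lists_4 by auto
      then show "ys \<in> {[a, b, c, d], [d, c, b, a]}"
        using graph_of_list_4_eq_iff[OF abcd(3), of a' b' c' d'] abcd(2) by simp
    qed (use abcd in \<open>auto simp: graph_of_list_4 insert_commute\<close>)
    then show ?thesis using abcd(3) by simp
  qed
  have "card ?T = (\<Sum>S\<in>graph_of_list ` ?T. card {ys \<in> ?T. graph_of_list ys = S})"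
    using sum.image_gen[OF finite_path_lists[OF assms], of "\<lambda>_. 1::nat"] by simp
  also have "\<dots> = 2 * card (graph_of_list ` ?T)" using fib by simp
  finally show ?thesis by (simp add: copies_path_graph)
qed

section \<open>The game value\<close>

definition legal_position :: "nat \<Rightarrow> nat set set \<Rightarrow> bool" where
  "legal_position n E \<longleftrightarrow> E \<subseteq> [{..<n}]\<^bsup>2\<^esup> \<and> p5free E"

definition P4_lists :: "'a set set \<Rightarrow> 'a list set" where
  "P4_lists E = {[a, b, c, d] | a b c d. distinct [a, b, c, d] \<and> {a, b} \<in> E \<and> {b, c} \<in> E \<and> {c, d} \<in> E}"

lemma edge_in_nsets:
  assumes "E \<subseteq> [V]\<^bsup>2\<^esup>" "{a, b} \<in> E"
  shows "a \<in> V" "b \<in> V" "a \<noteq> b"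
  using assms by (auto simp: nsets_def card_insert_if split: if_splits)

lemma P4_lists_eq:
  assumes "E \<subseteq> [V]\<^bsup>2\<^esup>"
  shows "P4_lists E = path_lists 4 V E"
  unfolding P4_lists_def path_lists_4 using edge_in_nsets[OF assms] by (intro Collect_cong) blast

lemma card_P4_lists:
  fixes n :: nat
  assumes "E \<subseteq> [{..<n}]\<^bsup>2\<^esup>"
  shows "card (P4_lists E) = 2 * card (copies (path_graph 4) ({..<n}, E))"
  using P4_lists_eq[OF assms] card_path_lists_4[of "{..<n}" E] by simp

lemma finite_P4_lists:
  fixes n :: nat
  assumes "E \<subseteq> [{..<n}]\<^bsup>2\<^esup>"
  shows "finite (P4_lists E)"
  using P4_lists_eq[OF assms] finite_path_lists[of "{..<n}" 4 E] by simp

lemma doubleton_in_nsets: "{x, y} \<in> [V]\<^bsup>2\<^esup> \<longleftrightarrow> x \<in> V \<and> y \<in> V \<and> x \<noteq> y"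
  by (auto simp: nsets_def card_insert_if)

lemma legal_move_iff:
  assumes "legal_position n E"
  shows "e \<in> legal_moves (path_graph 5) n E \<longleftrightarrow> e \<notin> E \<and> legal_position n (insert e E)"
proof (cases "e \<in> [{..<n}]\<^bsup>2\<^esup>")
  case True
  then have "insert e E \<subseteq> [{..<n}]\<^bsup>2\<^esup>" using assms by (simp add: legal_position_def)
  with True show ?thesis
    using free_of_path_graph_5[of "insert e E" "{..<n}"] by (simp add: legal_moves_def legal_position_def)
qed (simp add: legal_moves_def legal_position_def)

lemma finite_legal_moves: "finite (legal_moves F n E)"
  by (rule finite_subset[of _ "[{..<n}]\<^bsup>2\<^esup>"]) (auto simp: legal_moves_def finite_imp_finite_nsets)

lemma card_unclaimed_less:
  assumes "e \<in> legal_moves F n E"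
  shows "card ([{..<n}]\<^bsup>2\<^esup> - insert e E) < card ([{..<n}]\<^bsup>2\<^esup> - E)"
  using assms by (intro psubset_card_mono) (auto simp: legal_moves_def finite_imp_finite_nsets)

abbreviation val :: "nat \<Rightarrow> player \<Rightarrow> nat set set \<Rightarrow> nat" where
  "val n p E \<equiv> game_value (path_graph 4) (path_graph 5) n p E"

abbreviation score :: "nat \<Rightarrow> nat set set \<Rightarrow> nat" where
  "score n E \<equiv> card (copies (path_graph 4) ({..<n}, E))"

abbreviation moves :: "nat \<Rightarrow> nat set set \<Rightarrow> nat set set" where
  "moves n E \<equiv> legal_moves (path_graph 5) n E"

lemma val_terminal: "moves n E = {} \<Longrightarrow> val n p E = score n E"
  by (simp add: game_value.simps)

lemma val_MaxP: "moves n E \<noteq> {} \<Longrightarrow> val n MaxP E = Max ((\<lambda>e. val n MiniP (insert e E)) ` moves n E)"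
  by (subst game_value.simps) simp

lemma val_MiniP: "moves n E \<noteq> {} \<Longrightarrow> val n MiniP E = Min ((\<lambda>e. val n MaxP (insert e E)) ` moves n E)"
  by (subst game_value.simps) simp

lemma val_MaxP_ge:
  assumes "e \<in> moves n E" "c \<le> val n MiniP (insert e E)"
  shows "c \<le> val n MaxP E"
proof -
  have "moves n E \<noteq> {}" using assms(1) by blast
  then show ?thesis
    using assms by (simp add: val_MaxP Max_ge_iff finite_legal_moves) blast
qed

lemma val_MiniP_le:
  assumes "e \<in> moves n E" "val n MaxP (insert e E) \<le> c"
  shows "val n MiniP E \<le> c"
proof -
  have "moves n E \<noteq> {}" using assms(1) by blast
  then show ?thesis
    using assms by (simp add: val_MiniP Min_le_iff finite_legal_moves) blast
qed

lemma val_MiniP_ge: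
  assumes "moves n E = {} \<Longrightarrow> c \<le> score n E"
    and "\<And>e. e \<in> moves n E \<Longrightarrow> c \<le> val n MaxP (insert e E)"
  shows "c \<le> val n MiniP E"
  using assms by (cases "moves n E = {}") (auto simp: val_terminal val_MiniP Min_ge_iff finite_legal_moves)

lemma val_MaxP_le:
  assumes "moves n E = {} \<Longrightarrow> score n E \<le> c"
    and "\<And>e. e \<in> moves n E \<Longrightarrow> val n MiniP (insert e E) \<le> c"
  shows "val n MaxP E \<le> c"
  using assms by (cases "moves n E = {}") (auto simp: val_terminal val_MaxP Max_le_iff finite_legal_moves)

text \<open>Some actual play attains the value. A bound that holds for every terminal position above
  \<open>E\<close> thus bounds the value without any strategy; this is used for both players once
  their goal is secured.\<close>

lemma val_reachable:
  assumes "legal_position n E"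
  shows "\<exists>E'. E \<subseteq> E' \<and> legal_position n E' \<and> moves n E' = {} \<and> val n p E = score n E'"
  using assms
proof (induction "card ([{..<n}]\<^bsup>2\<^esup> - E)" arbitrary: E p rule: less_induct)
  case less
  show ?case
  proof (cases "moves n E = {}")
    case True
    then show ?thesis using less.prems val_terminal by blast
  next
    case False
    have "\<exists>e q. e \<in> moves n E \<and> val n p E = val n q (insert e E)"
    proof (cases p)
      case MaxP
      have "Max ((\<lambda>e. val n MiniP (insert e E)) ` moves n E) \<in> (\<lambda>e. val n MiniP (insert e E)) ` moves n E"
        using False by (intro Max_in) (auto simp: finite_legal_moves)
      with False MaxP show ?thesis by (auto simp: val_MaxP)
    next
      case MiniP
      have "Min ((\<lambda>e. val n MaxP (insert e E)) ` moves n E) \<in> (\<lambda>e. val n MaxP (insert e E)) ` moves n E"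
        using False by (intro Min_in) (auto simp: finite_legal_moves)
      with False MiniP show ?thesis by (auto simp: val_MiniP)
    qed
    then obtain e q where e: "e \<in> moves n E" "val n p E = val n q (insert e E)" by blast
    have "legal_position n (insert e E)" using e(1) less.prems legal_move_iff by blast
    from less.hyps[OF card_unclaimed_less[OF e(1)] this, of q]
    obtain E' where "insert e E \<subseteq> E'" "legal_position n E'" "moves n E' = {}"
        "val n q (insert e E) = score n E'"
      by blast
    then show ?thesis using e(2) by (intro exI[of _ E']) simp
  qed
qed

section \<open>Legality of moves and matchings\<close>

lemma legal_positionD:
  assumes "legal_position n E"
  shows "E \<subseteq> [{..<n}]\<^bsup>2\<^esup>" "p5free E" "{x, y} \<in> E \<Longrightarrow> x < n" "{x, y} \<in> E \<Longrightarrow> y < n"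
    "{x, y} \<in> E \<Longrightarrow> x \<noteq> y" "{x} \<notin> E"
  using assms edge_in_nsets[of E "{..<n}"] by (auto simp: legal_position_def nsets_def)

text \<open>A path cannot cross the border of \<open>W\<close>: inside there are too few vertices
  for it, and outside no edge is new.\<close>

lemma p5free_insert_closed:
  assumes "p5free E" "finite W" "card W \<le> 4" "e \<subseteq> W"
    and closed: "\<And>x y. {x, y} \<in> E \<Longrightarrow> x \<in> W \<Longrightarrow> y \<in> W"
  shows "p5free (insert e E)"
  unfolding p5free_def
proof (rule notI, elim exE conjE)
  fix a b c d f
  assume dist: "distinct [a, b, c, d, f]"
    and p: "{a, b} \<in> insert e E" "{b, c} \<in> insert e E" "{c, d} \<in> insert e E" "{d, f} \<in> insert e E"
  have iff: "x \<in> W \<longleftrightarrow> y \<in> W" if "{x, y} \<in> insert e E" for x y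
    using that assms(4) closed[of x y] closed[of y x] by (auto simp: insert_commute)
  show False
  proof (cases "a \<in> W")
    case True
    then have "{a, b, c, d, f} \<subseteq> W" using p[THEN iff] by simp
    from card_mono[OF assms(2) this] show False using dist assms(3) by simp
  next
    case False
    then have "a \<notin> W" "b \<notin> W" "c \<notin> W" "d \<notin> W" using p[THEN iff] by simp_all
    then have "{a, b} \<in> E" "{b, c} \<in> E" "{c, d} \<in> E" "{d, f} \<in> E" using p assms(4) by auto
    then show False using p5freeD[OF assms(1) _ _ _ _ dist] by blast
  qed
qed

text \<open>A new leaf at \<open>u\<close> is a twin of the old leaf \<open>l\<close>, so it may be replaced by \<open>l\<close> in any path.\<close>

lemma p5free_insert_twin_leaf:
  assumes "p5free E" and l: "{l, u} \<in> E" "l \<noteq> u" "\<And>y. {l, y} \<in> E \<Longrightarrow> y = u"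
    and x: "\<And>y. {x, y} \<notin> E"
  shows "p5free (insert {x, u} E)"
proof -
  have lx: "l \<noteq> x" using l(1) x by blast
  have xu: "x \<noteq> u" using l(1) x[of l] by (metis insert_commute)
  have x': "y = u" if "{x, y} \<in> insert {x, u} E" for y using that x by (auto simp: doubleton_eq_iff)
  have x'': "y = u" if "{y, x} \<in> insert {x, u} E" for y using x'[of y] that by (simp add: insert_commute)
  have l'': "y = u" if "{y, l} \<in> E" for y using l(3)[of y] that by (simp add: insert_commute)
  have noend: False if "distinct [x, b, c, d, f]"
    "{x, b} \<in> insert {x, u} E" "{b, c} \<in> insert {x, u} E" "{c, d} \<in> insert {x, u} E" "{d, f} \<in> insert {x, u} E"
    for b c d f
  proof -
    have b: "b = u" using x'[OF that(2)] .
    have p: "{b, c} \<in> E" "{c, d} \<in> E" "{d, f} \<in> E" using that by (auto simp: doubleton_eq_iff)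
    have "l \<noteq> c" "l \<noteq> d" "l \<noteq> f"
      using p l(3)[of d] l''[of c] l''[of d] that(1) b by auto
    then have "distinct [l, b, c, d, f]" using that(1) b l(2) by auto
    then show False using p5freeD[OF assms(1) _ p, of l] l(1) b by simp
  qed
  show ?thesis
    unfolding p5free_def
  proof (rule notI, elim exE conjE)
    fix a b c d f
    assume dist: "distinct [a, b, c, d, f]"
      and p: "{a, b} \<in> insert {x, u} E" "{b, c} \<in> insert {x, u} E" "{c, d} \<in> insert {x, u} E"
        "{d, f} \<in> insert {x, u} E"
    have rev: "distinct [f, d, c, b, a]" "{f, d} \<in> insert {x, u} E" "{d, c} \<in> insert {x, u} E"
      "{c, b} \<in> insert {x, u} E" "{b, a} \<in> insert {x, u} E"
      using dist p by (auto simp: insert_commute)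
    have "a \<noteq> x" using noend[of b c d f] dist p by metis
    moreover have "f \<noteq> x" using noend[of d c b a] rev by metis
    moreover have "b \<noteq> x" using x''[of a] x'[of c] p dist by auto
    moreover have "c \<noteq> x" using x''[of b] x'[of d] p dist by auto
    moreover have "d \<noteq> x" using x''[of c] x'[of f] p dist by auto
    ultimately have "{a, b} \<in> E" "{b, c} \<in> E" "{c, d} \<in> E" "{d, f} \<in> E"
      using p by (auto simp: doubleton_eq_iff)
    from p5freeD[OF assms(1) this dist] show False .
  qed
qed

definition matching :: "'a set set \<Rightarrow> bool" where
  "matching M \<longleftrightarrow> (\<forall>x y z. {x, y} \<in> M \<longrightarrow> {x, z} \<in> M \<longrightarrow> y = z)"

lemma matchingD: "matching M \<Longrightarrow> {x, y} \<in> M \<Longrightarrow> {x, z} \<in> M \<Longrightarrow> y = z"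
  by (auto simp: matching_def)

lemma covered_obtain:
  assumes "M \<subseteq> E" "legal_position n E" "x \<in> \<Union>M"
  obtains x' where "{x, x'} \<in> M" "{x, x'} \<in> E" "x \<noteq> x'" "x' \<in> \<Union>M"
proof -
  from assms(3) obtain e where e: "e \<in> M" "x \<in> e" by blast
  then have "e \<in> [{..<n}]\<^bsup>2\<^esup>" using assms(1,2) by (auto simp: legal_position_def)
  then obtain x' where "e = {x, x'}" "x \<noteq> x'"
    using e(2) unfolding nsets_def by (auto simp: card_2_iff)
  with e assms(1) show ?thesis by (intro that[of x']) blast+
qed

lemma matching_distinct:
  assumes "legal_position n E" "M \<subseteq> E" "matching M" "{x, x'} \<in> M" "{y, y'} \<in> M" "y \<noteq> x" "y \<noteq> x'"
  shows "distinct [x', x, y, y']"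
proof -
  have "x \<noteq> x'" "y \<noteq> y'" using assms legal_positionD(5)[OF assms(1)] by blast+
  moreover have "y' \<noteq> x" using matchingD[OF assms(3), of x x' y] assms by (auto simp: insert_commute)
  moreover have "y' \<noteq> x'" using matchingD[OF assms(3), of x' x y] assms by (auto simp: insert_commute)
  ultimately show ?thesis using assms by auto
qed

text \<open>The two matching edges and the edge between them form the path \<open>x' x y y'\<close>,
  and nothing outside can be adjacent to its ends. A covered outside neighbour \<open>w\<close> of
  \<open>x\<close> would bring its partner \<open>w'\<close> and the path
  \<open>w' w x y y'\<close>, likewise for \<open>y\<close>; so only uncovered vertices can hang at
  \<open>x\<close> and \<open>y\<close>.\<close>

lemma joined_pairs:
  assumes E: "legal_position n E" and M: "M \<subseteq> E" "matching M"
    and m: "{x, x'} \<in> M" "{y, y'} \<in> M" "{x, y} \<in> E" "y \<noteq> x'"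
  shows joined_pairs_ends: "w \<notin> {x', x, y, y'} \<Longrightarrow> {x', w} \<notin> E \<and> {y', w} \<notin> E"
    and joined_pairs_closed: "a \<in> {x', x, y, y'} \<Longrightarrow> {a, w} \<in> E \<Longrightarrow> w \<in> \<Union>M \<Longrightarrow> w \<in> {x', x, y, y'}"
proof -
  note pf = legal_positionD(2)[OF E]
  have dist: "distinct [x', x, y, y']"
    using matching_distinct[OF E M m(1,2)] m legal_positionD(5)[OF E m(3)] by auto
  have e: "{x', x} \<in> E" "{y, y'} \<in> E" "{x, y} \<in> E" using m M by (auto simp: insert_commute)
  show ends: "{x', w} \<notin> E \<and> {y', w} \<notin> E" if "w \<notin> {x', x, y, y'}" for w
    using p5freeD[OF pf, of w x' x y y'] p5freeD[OF pf, of w y' y x x'] that dist e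
    by (auto simp: insert_commute)
  show "w \<in> {x', x, y, y'}" if a: "a \<in> {x', x, y, y'}" "{a, w} \<in> E" "w \<in> \<Union>M" for a w
  proof (rule ccontr)
    assume w: "w \<notin> {x', x, y, y'}"
    obtain w' where w': "{w, w'} \<in> M" "{w, w'} \<in> E" "w \<noteq> w'" using covered_obtain[OF M(1) E a(3)] by blast
    have "w' \<notin> {x', x}" using matching_distinct[OF E M m(1) w'(1)] w by auto
    moreover have "w' \<notin> {y', y}" using matching_distinct[OF E M m(2) w'(1)] w by auto
    ultimately show False
      using ends[OF w] p5freeD[OF pf, of w' w x y y'] p5freeD[OF pf, of w' w y x x'] a(1,2) w dist e w'
      by (auto simp: insert_commute)
  qed
qed

section \<open>Saturated graphs with a large matching\<close>

text \<open>Every copy of P_4 is seen from both of its ends, so three copies per vertex amount to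
  six lists starting at each vertex.\<close>

definition P4_from :: "'a set set \<Rightarrow> 'a \<Rightarrow> 'a list set" where
  "P4_from E x = {xs \<in> P4_lists E. hd xs = x}"

lemma card_P4_lists_sum:
  assumes "legal_position n E"
  shows "card (P4_lists E) = (\<Sum>x<n. card (P4_from E x))"
proof -
  have fin: "finite (P4_lists E)" using finite_P4_lists assms by (auto simp: legal_position_def)
  have "P4_lists E = (\<Union>x\<in>{..<n}. P4_from E x)"
    using legal_positionD(3)[OF assms] unfolding P4_from_def P4_lists_def by fastforce
  also have "card \<dots> = (\<Sum>x<n. card (P4_from E x))"
    using fin by (intro card_UN_disjoint) (auto simp: P4_from_def)
  finally show ?thesis .
qed

lemma card_P4_from_clique:
  assumes "finite (P4_lists E)" "card W = 4" "v \<in> W"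
    and K: "\<And>p q. p \<in> W \<Longrightarrow> q \<in> W \<Longrightarrow> p \<noteq> q \<Longrightarrow> {p, q} \<in> E"
  shows "6 \<le> card (P4_from E v)"
proof -
  have "card (W - {v}) = 3" using assms(2,3) by simp
  then obtain a b c where W: "W - {v} = {a, b, c}" "a \<noteq> b" "a \<noteq> c" "b \<noteq> c" by (auto simp: card_3_iff)
  then have mem: "a \<in> W" "b \<in> W" "c \<in> W" "v \<noteq> a" "v \<noteq> b" "v \<noteq> c" by blast+
  let ?L = "{[v, a, b, c], [v, a, c, b], [v, b, a, c], [v, b, c, a], [v, c, a, b], [v, c, b, a]}"
  have "[v, p, q, r] \<in> P4_from E v" if "distinct [v, p, q, r]" "{p, q, r} \<subseteq> W" for p q r
    using that K assms(3) by (auto simp: P4_from_def P4_lists_def)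
  then have "?L \<subseteq> P4_from E v" using W mem by simp
  moreover have "finite (P4_from E v)" using assms(1) by (simp add: P4_from_def)
  ultimately have "card ?L \<le> card (P4_from E v)" by (rule card_mono[rotated])
  then show ?thesis using W mem by simp
qed

text \<open>A component of the graph induced on the covered vertices.\<close>

definition block :: "'a set set \<Rightarrow> 'a set set \<Rightarrow> 'a set \<Rightarrow> bool" where
  "block E M W \<longleftrightarrow> finite W \<and> W \<subseteq> \<Union>M \<and>
     (\<forall>a\<in>W. \<forall>b\<in>\<Union>M. {a, b} \<in> E \<longrightarrow> b \<in> W) \<and>
     (\<forall>U. W \<inter> U \<noteq> {} \<longrightarrow> (\<forall>a\<in>U. \<forall>b\<in>\<Union>M. {a, b} \<in> E \<longrightarrow> b \<in> U) \<longrightarrow> W \<subseteq> U)"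

lemma blockD:
  assumes "block E M W"
  shows "finite W" "W \<subseteq> \<Union>M" "a \<in> W \<Longrightarrow> {a, b} \<in> E \<Longrightarrow> b \<in> \<Union>M \<Longrightarrow> b \<in> W"
  using assms by (auto simp: block_def)

lemma blockI:
  assumes "finite W" "W \<subseteq> \<Union>M" "\<And>a b. a \<in> W \<Longrightarrow> {a, b} \<in> E \<Longrightarrow> b \<in> \<Union>M \<Longrightarrow> b \<in> W"
    and "\<And>U. W \<inter> U \<noteq> {} \<Longrightarrow> \<forall>a\<in>U. \<forall>b\<in>\<Union>M. {a, b} \<in> E \<longrightarrow> b \<in> U \<Longrightarrow> W \<subseteq> U"
  shows "block E M W"
  unfolding block_def
proof (intro conjI ballI impI allI)
  show "b \<in> W" if "a \<in> W" "b \<in> \<Union>M" "{a, b} \<in> E" for a b using assms(3)[OF that(1,3,2)] .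
  show "W \<subseteq> U" if "W \<inter> U \<noteq> {}" "\<forall>a\<in>U. \<forall>b\<in>\<Union>M. {a, b} \<in> E \<longrightarrow> b \<in> U" for U
    using assms(4)[OF that] .
qed (fact assms)+

lemma block_subset:
  assumes "block E M W" "block E M U" "a \<in> W" "a \<in> U"
  shows "W \<subseteq> U"
proof -
  have "W \<inter> U \<noteq> {}" using assms(3,4) by blast
  moreover have "\<forall>a\<in>U. \<forall>b\<in>\<Union>M. {a, b} \<in> E \<longrightarrow> b \<in> U" using blockD(3)[OF assms(2)] by simp
  ultimately show ?thesis using assms(1) by (simp add: block_def)
qed

text \<open>Either the matching edge at \<open>v\<close> has no further covered neighbour and is a
  block itself, or such a neighbour and its partner complete four vertices, which are closed by
  \<open>joined_pairs_closed\<close>.\<close>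

lemma block_exists:
  assumes E: "legal_position n E" and M: "M \<subseteq> E" "matching M" and v: "v \<in> \<Union>M"
  obtains W where "block E M W" "v \<in> W" "card W = 4 \<or> (\<exists>v'. v \<noteq> v' \<and> W = {v, v'} \<and> {v, v'} \<in> M)"
proof -
  obtain v' where v': "{v, v'} \<in> M" "{v, v'} \<in> E" "v \<noteq> v'" "v' \<in> \<Union>M"
    using covered_obtain[OF M(1) E v] by blast
  show ?thesis
  proof (cases "\<exists>x\<in>{v, v'}. \<exists>y\<in>\<Union>M. {x, y} \<in> E \<and> y \<notin> {v, v'}")
    case True
    then obtain x y where xy: "x \<in> {v, v'}" "y \<in> \<Union>M" "{x, y} \<in> E" "y \<notin> {v, v'}" by blast
    define x' where "x' = (if x = v then v' else v)"
    have x': "{x, x'} \<in> M" "{x, x'} = {v, v'}" "{x, x'} \<in> E" "y \<noteq> x" "y \<noteq> x'"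
      using xy v' by (auto simp: x'_def insert_commute)
    obtain y' where y': "{y, y'} \<in> M" "{y, y'} \<in> E" "y' \<in> \<Union>M" using covered_obtain[OF M(1) E xy(2)] by blast
    let ?W = "{x', x, y, y'}"
    have dist: "distinct [x', x, y, y']" using matching_distinct[OF E M x'(1) y'(1)] x' by simp
    have sub: "?W \<subseteq> \<Union>M" using x'(1) y'(1) by blast
    have closed: "b \<in> ?W" if "a \<in> ?W" "{a, b} \<in> E" "b \<in> \<Union>M" for a b
      using joined_pairs_closed[OF E M x'(1) y'(1) xy(3) x'(5) that] .
    have "?W \<subseteq> U" if "?W \<inter> U \<noteq> {}" and U: "\<forall>a\<in>U. \<forall>b\<in>\<Union>M. {a, b} \<in> E \<longrightarrow> b \<in> U" for U
    proof -
      have iff: "a \<in> U \<longleftrightarrow> b \<in> U" if "{a, b} \<in> E" "a \<in> \<Union>M" "b \<in> \<Union>M" for a b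
        using that U by (metis insert_commute)
      have "x' \<in> U \<longleftrightarrow> x \<in> U" "x \<in> U \<longleftrightarrow> y \<in> U" "y \<in> U \<longleftrightarrow> y' \<in> U"
        using iff[of x x'] iff[of x y] iff[of y y'] x'(3) xy(3) y'(2) sub by simp_all
      then show ?thesis using that(1) by auto
    qed
    then have "block E M ?W" by (intro blockI[OF _ sub closed]) simp_all
    moreover have "v \<in> ?W" using x'(2) by auto
    moreover have "card ?W = 4" using dist by simp
    ultimately show ?thesis using that by blast
  next
    case False
    have conn: "{v, v'} \<subseteq> U" if "{v, v'} \<inter> U \<noteq> {}" and U: "\<forall>a\<in>U. \<forall>b\<in>\<Union>M. {a, b} \<in> E \<longrightarrow> b \<in> U" for U
    proof -
      have "v \<in> U \<or> v' \<in> U" using that(1) by blast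
      moreover have "v' \<in> U" if "v \<in> U" using U that v'(2,4) by blast
      moreover have "v \<in> U" if "v' \<in> U" using U that v'(2) v insert_commute[of v v' "{}"] by metis
      ultimately show ?thesis by blast
    qed
    have "block E M {v, v'}"
    proof (rule blockI)
      show "b \<in> {v, v'}" if "a \<in> {v, v'}" "{a, b} \<in> E" "b \<in> \<Union>M" for a b
        using that False by blast
    qed (use v v' conn in auto)
    then show ?thesis using that[of "{v, v'}"] v' by blast
  qed
qed

text \<open>An uncovered \<open>z\<close> cannot touch two matching edges \<open>x' x\<close> and
  \<open>a a'\<close>, since \<open>x' x z a a'\<close> would be a path on five vertices. So it
  touches a single block and spoils at most four covered vertices.\<close>

lemma blocks_at_uncovered_vertex:
  assumes E: "legal_position n E" and M: "M \<subseteq> E" "matching M" and z: "z \<notin> \<Union>M"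
  shows "\<exists>R. finite R \<and> card R \<le> 4 \<and> (\<forall>W a. block E M W \<longrightarrow> a \<in> W \<longrightarrow> {a, z} \<in> E \<longrightarrow> W \<subseteq> R)"
proof (cases "\<exists>x\<in>\<Union>M. {x, z} \<in> E")
  case False
  then have "\<forall>W a. block E M W \<longrightarrow> a \<in> W \<longrightarrow> {a, z} \<in> E \<longrightarrow> W \<subseteq> {}"
    using blockD(2)[of E M] by blast
  then show ?thesis by (intro exI[of _ "{}"]) simp
next
  case True
  then obtain x where x: "x \<in> \<Union>M" "{x, z} \<in> E" by blast
  obtain x' where x': "{x, x'} \<in> M" "{x, x'} \<in> E" "x \<noteq> x'" "x' \<in> \<Union>M" using covered_obtain[OF M(1) E x(1)] by blast
  obtain R where R: "block E M R" "x \<in> R" and R4: "card R = 4 \<or> (\<exists>v'. x \<noteq> v' \<and> R = {x, v'} \<and> {x, v'} \<in> M)"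
    using block_exists[OF E M x(1)] by blast
  have "x' \<in> R" using blockD(3)[OF R(1,2) x'(2,4)] .
  have "W \<subseteq> R" if W: "block E M W" "a \<in> W" "{a, z} \<in> E" for W a
  proof -
    have "a \<in> {x, x'}"
    proof (rule ccontr)
      assume a: "a \<notin> {x, x'}"
      have "a \<in> \<Union>M" using W(1,2) blockD(2) by blast
      then obtain a' where a': "{a, a'} \<in> M" "{a, a'} \<in> E" "a' \<in> \<Union>M" using covered_obtain[OF M(1) E] by blast
      have "distinct [x', x, a, a']" using matching_distinct[OF E M x'(1) a'(1)] a by simp
      moreover have "z \<notin> {x', x, a, a'}" using z x'(4) x(1) a'(3) \<open>a \<in> \<Union>M\<close> by blast
      ultimately show False
        using p5freeD[OF legal_positionD(2)[OF E], of x' x z a a'] x' x(2) W(3) a'(2) by (auto simp: insert_commute)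
    qed
    then have "a \<in> R" using \<open>x' \<in> R\<close> R(2) by blast
    then show ?thesis using block_subset[OF W(1) R(1) W(2)] by blast
  qed
  moreover have "card R \<le> 4" using R4 by (auto simp: card_insert_if)
  ultimately show ?thesis using blockD(1)[OF R(1)] by blast
qed

lemma legal_inside_closed:
  assumes E: "legal_position n E" and W: "finite W" "card W \<le> 4" "p \<in> W" "q \<in> W" "p \<noteq> q" "p < n" "q < n"
    and closed: "\<And>x y. {x, y} \<in> E \<Longrightarrow> x \<in> W \<Longrightarrow> y \<in> W"
  shows "legal_position n (insert {p, q} E)"
proof -
  have "p5free (insert {p, q} E)"
    using p5free_insert_closed[OF legal_positionD(2)[OF E] W(1,2) _ closed] W(3,4) by auto
  then show ?thesis using E W by (auto simp: legal_position_def doubleton_in_nsets)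
qed

text \<open>All vertices outside an exceptional set \<open>B\<close> lie in a K_4 and start six
  lists. \<open>B\<close> has at most \<open>2 + 5 * t\<close> elements, and each of them costs at
  most three copies, whence \<open>15 * t + 6\<close>.\<close>

lemma score_ge_of_matching:
  assumes E: "legal_position n E" "moves n E = {}" and M: "M \<subseteq> E" "matching M"
    and t: "card ({..<n} - \<Union>M) \<le> t"
  shows "3 * n \<le> score n E + 15 * t + 6"
proof -
  let ?I = "{..<n} - \<Union>M"
  have Mn: "\<Union>M \<subseteq> {..<n}" using M(1) E(1) by (fastforce simp: legal_position_def nsets_def)
  \<comment> \<open>By saturation, a closed set of at most four vertices is a clique.\<close>
  have full: "{p, q} \<in> E" if "finite W" "card W \<le> 4" "p \<in> W" "q \<in> W" "p \<noteq> q" "p < n" "q < n"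
    "\<And>x y. {x, y} \<in> E \<Longrightarrow> x \<in> W \<Longrightarrow> y \<in> W" for p q W
  proof -
    have "legal_position n (insert {p, q} E)"
      by (rule legal_inside_closed[OF E(1) that(1-7)]) (rule that(8))
    then show ?thesis using legal_move_iff[OF E(1), of "{p, q}"] E(2) by simp
  qed
  \<comment> \<open>The ends of matching edges that are components of their own. Two such edges
    could still be joined legally, so a saturated graph has at most one.\<close>
  define K where "K = {v \<in> \<Union>M. \<exists>v'. v \<noteq> v' \<and> {v, v'} \<in> M \<and> (\<forall>a\<in>{v, v'}. \<forall>b. {a, b} \<in> E \<longrightarrow> b \<in> {v, v'})}"
  have K: "finite K \<and> card K \<le> 2"
  proof (cases "K = {}")
    case False
    then obtain v v' where v: "v \<in> \<Union>M" "v \<noteq> v'" "{v, v'} \<in> M"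
      "\<forall>a\<in>{v, v'}. \<forall>b. {a, b} \<in> E \<longrightarrow> b \<in> {v, v'}"
      unfolding K_def by blast
    have "K \<subseteq> {v, v'}"
    proof
      fix w assume "w \<in> K"
      then obtain w' where w: "w \<in> \<Union>M" "w \<noteq> w'" "{w, w'} \<in> M"
        "\<forall>a\<in>{w, w'}. \<forall>b. {a, b} \<in> E \<longrightarrow> b \<in> {w, w'}"
        unfolding K_def by blast
      show "w \<in> {v, v'}"
      proof (rule ccontr)
        assume "w \<notin> {v, v'}"
        then have "{v, w} \<notin> E" using v(4) by blast
        moreover have "{v, w} \<in> E"
        proof (rule full[of "{v, v', w, w'}"])
          show "card {v, v', w, w'} \<le> 4" by (simp add: card_insert_if)
          show "y \<in> {v, v', w, w'}" if "{x, y} \<in> E" "x \<in> {v, v', w, w'}" for x y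
            using that v(4) w(4) by blast
        qed (use Mn v w \<open>w \<notin> {v, v'}\<close> in auto)
        ultimately show False by blast
      qed
    qed
    then show ?thesis
      using finite_subset[of K "{v, v'}"] card_mono[of "{v, v'}" K] v(2) by auto
  qed simp
  obtain R where R: "\<And>z. z \<in> ?I \<Longrightarrow> finite (R z) \<and> card (R z) \<le> 4 \<and>
      (\<forall>W a. block E M W \<longrightarrow> a \<in> W \<longrightarrow> {a, z} \<in> E \<longrightarrow> W \<subseteq> R z)"
    using blocks_at_uncovered_vertex[OF E(1) M] by (metis DiffD2)
  \<comment> \<open>Besides \<open>K\<close>, each of the at most \<open>t\<close> uncovered
    vertices contributes itself and the at most four vertices of the block it touches.\<close>
  define B where "B = K \<union> (\<Union>z\<in>?I. R z) \<union> ?I"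
  have "finite B" unfolding B_def using K R by blast
  have "card (\<Union>z\<in>?I. R z) \<le> (\<Sum>z\<in>?I. card (R z))" by (intro card_UN_le) simp
  also have "\<dots> \<le> 4 * t" using sum_bounded_above[of ?I "\<lambda>z. card (R z)" 4] R t by force
  finally have "card B \<le> 2 + 4 * t + t"
    unfolding B_def using K t card_Un_le[of "K \<union> (\<Union>z\<in>?I. R z)" ?I] card_Un_le[of K "\<Union>z\<in>?I. R z"] by linarith
  have "6 \<le> card (P4_from E v)" if v: "v \<in> {..<n} - B" for v
  proof -
    have "v \<in> \<Union>M" using v by (auto simp: B_def)
    then obtain W where W: "block E M W" "v \<in> W"
      and shape: "card W = 4 \<or> (\<exists>v'. v \<noteq> v' \<and> W = {v, v'} \<and> {v, v'} \<in> M)"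
      using block_exists[OF E(1) M] by blast
    have closed: "b \<in> W" if ab: "{a, b} \<in> E" "a \<in> W" for a b
    proof (rule ccontr)
      assume "b \<notin> W"
      then have "b \<notin> \<Union>M" using blockD(3)[OF W(1)] ab by blast
      then have "b \<in> ?I" using legal_positionD(4)[OF E(1) ab(1)] by simp
      then have "v \<in> B" unfolding B_def using R W ab by blast
      then show False using v by blast
    qed
    have "v \<notin> K" using v by (simp add: B_def)
    have "card W = 4"
    proof (rule ccontr)
      assume "card W \<noteq> 4"
      then obtain v' where "v \<noteq> v'" "W = {v, v'}" "{v, v'} \<in> M" using shape by blast
      then have "v \<in> K" using closed \<open>v \<in> \<Union>M\<close> unfolding K_def by blast
      then show False using \<open>v \<notin> K\<close> by blast
    qed
    have Wn: "W \<subseteq> {..<n}" using blockD(2)[OF W(1)] Mn by blast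
    show ?thesis
    proof (rule card_P4_from_clique[OF finite_P4_lists \<open>card W = 4\<close> W(2)])
      show "{p, q} \<in> E" if "p \<in> W" "q \<in> W" "p \<noteq> q" for p q
        using full[OF blockD(1)[OF W(1)] _ that] closed Wn that \<open>card W = 4\<close> by auto
    qed (use legal_positionD(1)[OF E(1)] in blast)
  qed
  then have "6 * card ({..<n} - B) \<le> (\<Sum>x\<in>{..<n} - B. card (P4_from E x))"
    using sum_bounded_below[of "{..<n} - B" 6 "\<lambda>x. card (P4_from E x)"] by (simp add: mult.commute)
  also have "\<dots> \<le> (\<Sum>x<n. card (P4_from E x))" by (intro sum_mono2) auto
  also have "\<dots> = 2 * score n E"
    using card_P4_lists_sum[OF E(1)] card_P4_lists[OF legal_positionD(1)[OF E(1)]] by simp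
  finally have "6 * card ({..<n} - B) \<le> 2 * score n E" .
  moreover have "n - card B \<le> card ({..<n} - B)" using diff_card_le_card_Diff[OF \<open>finite B\<close>, of "{..<n}"] by simp
  ultimately show ?thesis using \<open>card B \<le> 2 + 4 * t + t\<close> by linarith
qed

section \<open>Growing a double star\<close>

definition isolated :: "nat \<Rightarrow> nat set set \<Rightarrow> nat set" where
  "isolated n E = {..<n} - \<Union>E"

lemma isolated_iff:
  assumes "legal_position n E"
  shows "x \<in> isolated n E \<longleftrightarrow> x < n \<and> (\<forall>y. {x, y} \<notin> E)"
proof -
  have "\<exists>y. {x, y} \<in> E" if "x \<in> \<Union>E" using covered_obtain[OF order_refl assms that] by blast
  then show ?thesis by (auto simp: isolated_def)
qed

lemma isolated_no_edge:
  assumes "x \<in> isolated n E"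
  shows "{x, y} \<notin> E" "{y, x} \<notin> E"
  using assms by (auto simp: isolated_def)

lemma finite_isolated [simp]: "finite (isolated n E)"
  by (simp add: isolated_def)

lemma move_obtain:
  assumes "legal_position n E" "e \<in> moves n E"
  obtains x y where "e = {x, y}" "x < n" "y < n" "x \<noteq> y" "{x, y} \<notin> E" "legal_position n (insert {x, y} E)"
proof -
  have e: "e \<notin> E" "legal_position n (insert e E)" using assms legal_move_iff by blast+
  then have "e \<in> [{..<n}]\<^bsup>2\<^esup>" by (simp add: legal_position_def)
  then obtain x y where "e = {x, y}" "x < n" "y < n" "x \<noteq> y"
    by (auto simp: nsets_def card_2_iff)
  then show ?thesis using e that by blast
qed

lemma card_isolated_insert_le: "card (isolated n E) \<le> card (isolated n (insert {x, y} E)) + 2"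
proof -
  have "card (isolated n E) \<le> card (isolated n (insert {x, y} E) \<union> {x, y})"
    by (intro card_mono) (auto simp: isolated_def)
  also have "\<dots> \<le> card (isolated n (insert {x, y} E)) + card {x, y}" by (rule card_Un_le)
  also have "\<dots> \<le> card (isolated n (insert {x, y} E)) + 2" by (simp add: card_insert_if)
  finally show ?thesis .
qed

lemma card_isolated_move_le:
  assumes "legal_position n E" "e \<in> moves n E"
  shows "card (isolated n E) \<le> card (isolated n (insert e E)) + 2"
  using move_obtain[OF assms] card_isolated_insert_le by metis

text \<open>\<open>A\<close> and \<open>B\<close> are merely sets of neighbours, which makes the
  notion monotone in \<open>E\<close>. With at least two vertices on each side, P_5-freeness forces
  them to be leaves (\<open>double_star_leaf\<close>).\<close>

definition double_star :: "'a set set \<Rightarrow> 'a \<Rightarrow> 'a \<Rightarrow> 'a set \<Rightarrow> 'a set \<Rightarrow> bool" where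
  "double_star E u v A B \<longleftrightarrow> {u, v} \<in> E \<and> u \<noteq> v \<and> u \<notin> A \<union> B \<and> v \<notin> A \<union> B \<and> A \<inter> B = {} \<and>
     (\<forall>a\<in>A. {a, u} \<in> E) \<and> (\<forall>b\<in>B. {b, v} \<in> E) \<and> 2 \<le> card A \<and> 2 \<le> card B"

lemma double_starD:
  assumes "double_star E u v A B"
  shows "{u, v} \<in> E" "u \<noteq> v" "u \<notin> A" "u \<notin> B" "v \<notin> A" "v \<notin> B" "A \<inter> B = {}"
    "a \<in> A \<Longrightarrow> {a, u} \<in> E" "b \<in> B \<Longrightarrow> {b, v} \<in> E" "2 \<le> card A" "2 \<le> card B" "finite A" "finite B"
  using assms by (auto simp: double_star_def intro: card_ge_0_finite)

lemma double_star_sym: "double_star E u v A B \<Longrightarrow> double_star E v u B A"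
  by (auto simp: double_star_def insert_commute)

lemma double_star_mono: "double_star E u v A B \<Longrightarrow> E \<subseteq> E' \<Longrightarrow> double_star E' u v A B"
  by (auto simp: double_star_def)

lemma ex_other_mem:
  assumes "2 \<le> card A"
  obtains a' where "a' \<in> A" "a' \<noteq> a"
proof -
  have "A - {a} \<noteq> {}"
  proof
    assume "A - {a} = {}"
    then have "card A \<le> card {a}" by (intro card_mono) auto
    then show False using assms by simp
  qed
  then show ?thesis using that by blast
qed

text \<open>A second neighbour \<open>y\<close> of \<open>a\<close> prolongs a path through the
  centers. Having two leaves on each side, one can choose \<open>a'\<close> different from
  \<open>a\<close> and \<open>b\<close> different from \<open>y\<close>.\<close>

lemma double_star_leaf:
  assumes "p5free E" and ds: "double_star E u v A B" and a: "a \<in> A" "{a, y} \<in> E" "a \<noteq> y"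
  shows "y = u"
proof (rule ccontr)
  assume y: "y \<noteq> u"
  note d = double_starD[OF ds]
  obtain a' where a': "a' \<in> A" "a' \<noteq> a" using ex_other_mem[OF d(10)] by blast
  obtain b where b: "b \<in> B" "b \<noteq> y" using ex_other_mem[OF d(11)] by blast
  have e: "{a', u} \<in> E" "{a, u} \<in> E" "{b, v} \<in> E" "{u, v} \<in> E" using d(1,8,9) a' a b by blast+
  have ne: "a \<noteq> u" "a \<noteq> v" "a' \<noteq> u" "a' \<noteq> v" "b \<noteq> u" "b \<noteq> v" "a \<noteq> b" "a' \<noteq> b" "u \<noteq> v"
    using d(2-7) a(1) a'(1) b(1) by auto
  consider "y = v" | "y \<in> B" | "y \<noteq> v" "y \<notin> B" by blast
  then show False
  proof cases
    case 1
    then show False using p5freeD[OF assms(1), of a' u a v b] e ne a a'(2) by (auto simp: insert_commute)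
  next
    case 2
    then have "{y, v} \<in> E" "y \<noteq> a'" "y \<noteq> v" using d(6,7,9) a' by auto
    then show False using p5freeD[OF assms(1), of a' u a y v] e ne a a'(2) y by (auto simp: insert_commute)
  next
    case 3
    then show False using p5freeD[OF assms(1), of y a u v b] e ne a b y by (auto simp: insert_commute)
  qed
qed

text \<open>An old leaf at \<open>u\<close> serves as the twin of the new one, so Mini can never
  stop the growth while isolated vertices remain.\<close>

lemma double_star_attach:
  assumes E: "legal_position n E" and ds: "double_star E u v A B" and x: "x \<in> isolated n E"
  shows "legal_position n (insert {x, u} E)" "{x, u} \<in> moves n E"
    "double_star (insert {x, u} E) u v (insert x A) B" "x \<notin> A"
    "card (isolated n E) \<le> card (isolated n (insert {x, u} E)) + 1"
proof -
  note d = double_starD[OF ds]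
  obtain a where a: "a \<in> A" using d(10) by fastforce
  have au: "{a, u} \<in> E" "a \<noteq> u" using d(8)[OF a] d(3) a by auto
  have un: "u < n" using legal_positionD(4)[OF E au(1)] .
  have xn: "x < n" using x by (simp add: isolated_def)
  note ne = isolated_no_edge[OF x]
  have "x \<noteq> u" "x \<noteq> v" using d(1) ne by blast+
  have xA: "x \<notin> A" using d(8) ne by blast
  have xB: "x \<notin> B" using d(9) ne by blast
  have leaf: "y = u" if "{a, y} \<in> E" for y
    using double_star_leaf[OF legal_positionD(2)[OF E] ds a that] legal_positionD(5)[OF E that] .
  have "p5free (insert {x, u} E)"
    using p5free_insert_twin_leaf[OF legal_positionD(2)[OF E] au leaf ne(1)] .
  then show E': "legal_position n (insert {x, u} E)"
    using E un xn \<open>x \<noteq> u\<close> by (simp add: legal_position_def doubleton_in_nsets)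
  show "{x, u} \<in> moves n E" using legal_move_iff[OF E] E' ne(1) by blast
  show "x \<notin> A" by fact
  have "2 \<le> card (insert x A)" using d(10) by (simp add: card_insert_if d(12))
  then show "double_star (insert {x, u} E) u v (insert x A) B"
    using ds \<open>x \<noteq> u\<close> \<open>x \<noteq> v\<close> xB unfolding double_star_def by auto
  have "card (isolated n E) \<le> card (insert x (isolated n (insert {x, u} E)))"
    using au(1) by (intro card_mono) (auto simp: isolated_def)
  also have "\<dots> \<le> card (isolated n (insert {x, u} E)) + 1" by (simp add: card_insert_if)
  finally show "card (isolated n E) \<le> card (isolated n (insert {x, u} E)) + 1" .
qed

text \<open>Only the lists running from \<open>A\<close> to \<open>B\<close> are counted, not their
  reversals. The lost factor of two merely affects the constant in front of sqrt n.\<close>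

lemma double_star_score:
  assumes E: "legal_position n E" and ds: "double_star E u v A B"
  shows "card A * card B \<le> 2 * score n E"
proof -
  note d = double_starD[OF ds]
  have "card A * card B = card ((\<lambda>(a, b). [a, u, v, b]) ` (A \<times> B))"
    by (subst card_image) (auto simp: inj_on_def card_cartesian_product)
  also have "\<dots> \<le> card (P4_lists E)"
  proof (rule card_mono[OF finite_P4_lists[OF legal_positionD(1)[OF E]]], safe)
    fix a b assume ab: "a \<in> A" "b \<in> B"
    then have "{a, u} \<in> E" "{v, b} \<in> E" using d(8)[of a] d(9)[of b] by (auto simp: insert_commute)
    moreover have "distinct [a, u, v, b]" using ab d(2-7) by auto
    ultimately show "[a, u, v, b] \<in> P4_lists E" using d(1) by (auto simp: P4_lists_def)
  qed
  also have "\<dots> = 2 * score n E" using card_P4_lists[OF legal_positionD(1)[OF E]] .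
  finally show ?thesis .
qed

text \<open>\<open>j\<close> and \<open>k\<close> are the numbers of leaves still to be added at
  \<open>u\<close> and at \<open>v\<close>. Each costs three isolated vertices: one for the leaf,
  and up to two for Mini's next move.\<close>

lemma val_MaxP_double_star:
  assumes "legal_position n E" "double_star E u v A B" "3 * (j + k) \<le> card (isolated n E)"
  shows "(card A + j) * (card B + k) \<le> 2 * val n MaxP E"
  using assms
proof (induction "j + k" arbitrary: E u v A B j k)
  case 0
  obtain E' where E': "E \<subseteq> E'" "legal_position n E'" "val n MaxP E = score n E'"
    using val_reachable[OF 0(2), of MaxP] by blast
  have "card A * card B \<le> 2 * score n E'"
    using double_star_score[OF E'(2) double_star_mono[OF 0(3) E'(1)]] .
  then show ?case using 0 E'(3) by simp
next
  case (Suc s)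
  \<comment> \<open>Stated for an arbitrary orientation of the double star, so that adding a leaf at
    \<open>v\<close> is the same step with the centers exchanged.\<close>
  have step: "(card A + Suc j) * (card B + k) \<le> 2 * val n MaxP E"
    if s: "Suc s = Suc j + k" and ds: "double_star E u v A B" and N: "3 * (Suc j + k) \<le> card (isolated n E)"
    for u v A B j k
  proof -
    have "isolated n E \<noteq> {}" using N by auto
    then obtain x where x: "x \<in> isolated n E" by blast
    let ?E = "insert {x, u} E"
    note at = double_star_attach[OF Suc.prems(1) ds x]
    let ?c = "(card A + Suc j) * (card B + k)"
    have fin: "finite A" using double_starD(12)[OF ds] .
    have ge: "?c \<le> 2 * val n MaxP (insert e ?E)" if e: "e \<in> moves n ?E" for e
    proof -
      have E'': "legal_position n (insert e ?E)" using legal_move_iff[OF at(1)] e by blast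
      have "card (isolated n ?E) \<le> card (isolated n (insert e ?E)) + 2"
        using card_isolated_move_le[OF at(1) e] .
      moreover have "3 * (Suc j + k) = 3 * (j + k) + 3" by simp
      ultimately have "3 * (j + k) \<le> card (isolated n (insert e ?E))" using N at(5) by linarith
      moreover have "double_star (insert e ?E) u v (insert x A) B" using double_star_mono[OF at(3)] by blast
      ultimately have "(card (insert x A) + j) * (card B + k) \<le> 2 * val n MaxP (insert e ?E)"
        using Suc.hyps(1)[OF _ E''] s by simp
      then show ?thesis using at(4) fin by simp
    qed
    have "isolated n ?E \<noteq> {}" using N at(5) by auto
    then obtain x2 where "x2 \<in> isolated n ?E" by blast
    then have "{x2, u} \<in> moves n ?E" using double_star_attach(2)[OF at(1,3)] by blast
    \<comment> \<open>The induction hypothesis bounds twice the value, whereas the rules for moves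
      bound the value itself; rounding the half up loses nothing.\<close>
    then have "(?c + 1) div 2 \<le> val n MiniP ?E"
    proof (intro val_MiniP_ge)
      fix e assume "e \<in> moves n ?E"
      then show "(?c + 1) div 2 \<le> val n MaxP (insert e ?E)" using ge[of e] by linarith
    qed auto
    then have "(?c + 1) div 2 \<le> val n MaxP E" using val_MaxP_ge[OF at(2)] by blast
    then show ?thesis by linarith
  qed
  show ?case
  proof (cases j)
    case (Suc j')
    then show ?thesis using step[of j' k u v A B] Suc.hyps(2) Suc.prems by simp
  next
    case 0
    then obtain k' where k: "k = Suc k'" using Suc.hyps(2) by (cases k) auto
    have "(card B + Suc k') * (card A + j) \<le> 2 * val n MaxP E"
      using Suc.hyps(2) Suc.prems(3) k by (intro step[OF _ double_star_sym[OF Suc.prems(2)]]) auto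
    then show ?thesis using k by (simp add: mult.commute)
  qed
qed

section \<open>Max's strategy\<close>

definition leaf_at :: "'a set set \<Rightarrow> 'a \<Rightarrow> 'a \<Rightarrow> bool" where
  "leaf_at E l v \<longleftrightarrow> {l, v} \<in> E \<and> (\<forall>y. {l, y} \<in> E \<longrightarrow> y = v)"

text \<open>Among the graphs on four vertices with a perfect matching, only the triangle with a
  pendant edge violates this condition.\<close>

definition leaf_nbrs_small :: "'a set set \<Rightarrow> bool" where
  "leaf_nbrs_small E \<longleftrightarrow>
     (\<forall>l v p q. leaf_at E l v \<longrightarrow> {v, p} \<in> E \<longrightarrow> {v, q} \<in> E \<longrightarrow> p \<noteq> l \<longrightarrow> q \<noteq> l \<longrightarrow> p = q)"

lemma leaf_atD: "leaf_at E l v \<Longrightarrow> {l, y} \<in> E \<Longrightarrow> y = v" "leaf_at E l v \<Longrightarrow> {l, v} \<in> E"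
  by (simp_all add: leaf_at_def)

lemma leaf_nbrs_smallD:
  "leaf_nbrs_small E \<Longrightarrow> leaf_at E l v \<Longrightarrow> {v, p} \<in> E \<Longrightarrow> {v, q} \<in> E \<Longrightarrow> p \<noteq> l \<Longrightarrow> q \<noteq> l \<Longrightarrow> p = q"
  unfolding leaf_nbrs_small_def by blast

text \<open>A leaf outside the closed set \<open>W\<close> has its neighbour outside as well, and
  all edges there are old.\<close>

lemma leaf_nbrs_small_local:
  assumes E: "leaf_nbrs_small E" "E \<subseteq> E'"
    and closed: "\<And>x y. {x, y} \<in> E' \<Longrightarrow> x \<in> W \<Longrightarrow> y \<in> W"
    and out: "\<And>e. e \<in> E' \<Longrightarrow> e \<notin> E \<Longrightarrow> e \<subseteq> W"
    and W: "\<And>l v p q. l \<in> W \<Longrightarrow> leaf_at E' l v \<Longrightarrow> {v, p} \<in> E' \<Longrightarrow> {v, q} \<in> E' \<Longrightarrow>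
      p \<noteq> l \<Longrightarrow> q \<noteq> l \<Longrightarrow> p = q"
  shows "leaf_nbrs_small E'"
  unfolding leaf_nbrs_small_def
proof (intro allI impI)
  fix l v p q
  assume a: "leaf_at E' l v" "{v, p} \<in> E'" "{v, q} \<in> E'" "p \<noteq> l" "q \<noteq> l"
  show "p = q"
  proof (cases "l \<in> W")
    case True
    then show ?thesis using W a by blast
  next
    case False
    note lv = leaf_atD(2,1)[OF a(1)]
    have "v \<notin> W" using closed[of v l] lv(1) False by (auto simp: insert_commute)
    then have "{l, v} \<in> E" "{v, p} \<in> E" "{v, q} \<in> E"
      using out[OF lv(1)] out[OF a(2)] out[OF a(3)] by auto
    moreover have "leaf_at E l v" unfolding leaf_at_def using \<open>{l, v} \<in> E\<close> lv(2) E(2) by blast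
    ultimately show ?thesis using leaf_nbrs_smallD[OF E(1)] a(4,5) by blast
  qed
qed

text \<open>The positions Max tries to leave behind: every component is an isolated vertex, an edge, or
  a graph on four vertices with a perfect matching other than the triangle with a pendant edge.\<close>

definition matched_position :: "nat \<Rightarrow> nat set set \<Rightarrow> bool" where
  "matched_position n E \<longleftrightarrow> legal_position n E \<and> leaf_nbrs_small E \<and>
     (\<exists>M. M \<subseteq> E \<and> matching M \<and> \<Union>M = \<Union>E)"

lemma matched_positionI:
  "legal_position n E \<Longrightarrow> leaf_nbrs_small E \<Longrightarrow> M \<subseteq> E \<Longrightarrow> matching M \<Longrightarrow> \<Union>M = \<Union>E \<Longrightarrow> matched_position n E"
  unfolding matched_position_def by blast

lemma matching_insert:
  assumes "matching M" "x \<notin> \<Union>M" "y \<notin> \<Union>M"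
  shows "matching (insert {x, y} M)"
  unfolding matching_def
proof (intro allI impI)
  fix a b c assume "{a, b} \<in> insert {x, y} M" "{a, c} \<in> insert {x, y} M"
  then show "b = c" using assms(2,3) matchingD[OF assms(1), of a b c] by (auto simp: doubleton_eq_iff)
qed

lemma matching_subset: "matching M \<Longrightarrow> M' \<subseteq> M \<Longrightarrow> matching M'"
  unfolding matching_def by blast

lemma matched_position_add_pair:
  assumes E: "matched_position n E" and x: "x \<in> isolated n E" and y: "y \<in> isolated n E" and "x \<noteq> y"
  shows "matched_position n (insert {x, y} E)" "{x, y} \<in> moves n E"
proof -
  have E': "legal_position n E" "leaf_nbrs_small E" using E by (auto simp: matched_position_def)
  obtain M where M: "M \<subseteq> E" "matching M" "\<Union>M = \<Union>E" using E by (auto simp: matched_position_def)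
  have edge: "legal_position n (insert {x, y} E)"
  proof (rule legal_inside_closed[OF E'(1), of "{x, y}"])
    show "b \<in> {x, y}" if "{a, b} \<in> E" "a \<in> {x, y}" for a b
      using that isolated_no_edge[OF x] isolated_no_edge[OF y] by blast
  qed (use x y \<open>x \<noteq> y\<close> in \<open>auto simp: isolated_def\<close>)
  then show "{x, y} \<in> moves n E" using legal_move_iff[OF E'(1)] isolated_no_edge[OF x] by blast
  have "leaf_nbrs_small (insert {x, y} E)"
  proof (rule leaf_nbrs_small_local[OF E'(2), of _ "{x, y}"])
    show "b \<in> {x, y}" if "{a, b} \<in> insert {x, y} E" "a \<in> {x, y}" for a b
      using that isolated_no_edge[OF x, of b] isolated_no_edge[OF y, of b] by (auto simp: doubleton_eq_iff)
    show "p = q" if "l \<in> {x, y}" "leaf_at (insert {x, y} E) l v" "{v, p} \<in> insert {x, y} E"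
      "{v, q} \<in> insert {x, y} E" "p \<noteq> l" "q \<noteq> l" for l v p q
    proof -
      have "{l, v} \<in> insert {x, y} E" using that(2) by (simp add: leaf_at_def)
      then have "v \<in> {x, y}" using that(1) isolated_no_edge[OF x, of v] isolated_no_edge[OF y, of v]
        by (auto simp: doubleton_eq_iff)
      then have "{v, p} = {x, y}" "{v, q} = {x, y}"
        using that(3,4) isolated_no_edge[OF x] isolated_no_edge[OF y] by blast+
      then show ?thesis by (metis doubleton_eq_iff)
    qed
  qed auto
  moreover have "matching (insert {x, y} M)"
    using matching_insert[OF M(2)] x y M(3) by (auto simp: isolated_def)
  moreover have "\<Union>(insert {x, y} M) = \<Union>(insert {x, y} E)" using M(3) by simp
  ultimately show "matched_position n (insert {x, y} E)"
    using matched_positionI[OF edge, of "insert {x, y} M"] M(1) by (simp add: subset_insertI2 subset_iff)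
qed

lemma ex_isolated_pair:
  assumes "2 \<le> card (isolated n E)"
  obtains x y where "x \<in> isolated n E" "y \<in> isolated n E" "x \<noteq> y"
  using ex_other_mem[OF assms] by metis

lemma matched_position_wait:
  assumes "matched_position n E" "2 \<le> card (isolated n E)"
  shows "\<exists>e\<in>moves n E. matched_position n (insert e E)"
  using ex_isolated_pair[OF assms(2)] matched_position_add_pair[OF assms(1)] by metis

text \<open>If Mini has made a path on three vertices, Max prolongs it; if Mini has attached a vertex to the
  inside of a path on four vertices, Max balances the resulting double star.\<close>

lemma reply_to_attachment:
  assumes K: "matched_position n E" and x: "x \<in> isolated n E" and y: "y \<in> \<Union>E"
    and E': "legal_position n (insert {x, y} E)" and N: "2 \<le> card (isolated n E)"
  shows "\<exists>e\<in>moves n (insert {x, y} E). matched_position n (insert e (insert {x, y} E)) \<or>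
    (\<exists>u v A B. double_star (insert e (insert {x, y} E)) u v A B)"
proof -
  let ?E = "insert {x, y} E"
  have E: "legal_position n E" "leaf_nbrs_small E" using K by (auto simp: matched_position_def)
  obtain M where M: "M \<subseteq> E" "matching M" "\<Union>M = \<Union>E" using K by (auto simp: matched_position_def)
  have M': "M \<subseteq> ?E" using M(1) by blast
  note pf = legal_positionD(2)[OF E']
  note nx = isolated_no_edge[OF x]
  obtain y' where y': "{y, y'} \<in> M" "{y, y'} \<in> E" "y \<noteq> y'" "y' \<in> \<Union>M"
    using covered_obtain[OF M(1) E(1)] y M(3) by metis
  have xy: "x \<noteq> y" "x \<noteq> y'" using nx y'(2) legal_positionD(5)[OF E', of x y] by auto
  obtain z where z: "z \<in> isolated n E" "z \<noteq> x" using ex_other_mem[OF N] by blast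
  note nz = isolated_no_edge[OF z(1)]
  have zy: "z \<noteq> y" "z \<noteq> y'" using nz y'(2) by auto
  have nz': "{z, w} \<notin> ?E" for w using nz(1)[of w] z(2) zy(1) by (auto simp: doubleton_eq_iff)
  have zn: "z < n" using z(1) by (simp add: isolated_def)
  have yn: "y < n" "y' < n" using legal_positionD(3,4)[OF E(1) y'(2)] .
  show ?thesis
  proof (cases "\<exists>c. {y, c} \<in> E \<and> c \<noteq> y'")
    \<comment> \<open>The component of \<open>y\<close> in \<open>E\<close> is the path
      \<open>y' y c d\<close>. Max attaches \<open>z\<close> to \<open>c\<close>, which leaves
      \<open>x\<close>, \<open>y'\<close> at the center \<open>y\<close> and \<open>d\<close>,
      \<open>z\<close> at the center \<open>c\<close>.\<close>
    case True
    then obtain c where c: "{y, c} \<in> E" "c \<noteq> y'" by blast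
    have "c \<in> \<Union>M" using c(1) M(3) by blast
    then obtain d where d: "{c, d} \<in> M" "{c, d} \<in> E" "c \<noteq> d" using covered_obtain[OF M(1) E(1)] by metis
    have yc: "c \<noteq> y" using legal_positionD(5)[OF E(1) c(1)] by simp
    have dist: "distinct [y', y, c, d]" using matching_distinct[OF E(1) M(1,2) y'(1) d(1) yc c(2)] .
    have xW: "x \<noteq> c" "x \<noteq> d" using nx d(2) by auto
    have zW: "z \<noteq> c" "z \<noteq> d" using nz d(2) by auto
    have c': "{y, c} \<in> ?E" using c(1) by simp
    note ends = joined_pairs_ends[OF E' M' M(2) y'(1) d(1) c' c(2)]
    have cd: "{d, c} \<in> ?E" using d(2) by (simp add: insert_commute)
    \<comment> \<open>\<open>d\<close> must be a leaf to serve as the twin of \<open>z\<close>. An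
      edge from \<open>d\<close> to \<open>y'\<close> would give the path \<open>x y y' d c\<close>;
      an edge from \<open>d\<close> to \<open>y\<close> would make \<open>E\<close> contain a
      triangle with the pendant edge \<open>y' y\<close>, which is where
      \<open>leaf_nbrs_small\<close> enters.\<close>
    have leaf: "w = c" if w: "{d, w} \<in> ?E" for w
    proof (rule ccontr)
      assume "w \<noteq> c"
      moreover have "w \<noteq> d" using legal_positionD(5)[OF E' w] by simp
      ultimately have "w = y' \<or> w = y" using ends[of w] w by blast
      then show False
      proof
        assume "w = y'"
        then show False
          using p5freeD[OF pf, of x y y' d c] xy xW dist w cd y'(2) by (auto simp: insert_commute)
      next
        assume w': "w = y"
        have "leaf_at E y' y" unfolding leaf_at_def
        proof (intro conjI allI impI)
          show "{y', y} \<in> E" using y'(2) by (simp add: insert_commute)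
          fix t assume t: "{y', t} \<in> E"
          show "t = y"
          proof (rule ccontr)
            assume "t \<noteq> y"
            moreover have "t \<noteq> y'" using legal_positionD(5)[OF E(1) t] by simp
            ultimately have "t = c \<or> t = d" using ends[of t] t by blast
            then show False
              using p5freeD[OF pf, of x y y' c d] p5freeD[OF pf, of x y y' d c] xy xW dist t y'(2) d(2) cd
              by (auto simp: insert_commute)
          qed
        qed
        moreover have "{y, d} \<in> E" using w w' xW xy dist by (auto simp: insert_commute doubleton_eq_iff)
        ultimately have "c = d" using leaf_nbrs_smallD[OF E(2)] c dist by auto
        then show False using d(3) by blast
      qed
    qed
    have zc: "z \<noteq> c" by fact
    have "p5free (insert {z, c} ?E)"
      using p5free_insert_twin_leaf[OF pf cd _ leaf nz'] d(3) by blast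
    moreover have "c < n" using legal_positionD(3)[OF E(1) d(2)] .
    ultimately have "legal_position n (insert {z, c} ?E)"
      using E' zn zc by (simp add: legal_position_def doubleton_in_nsets)
    then have "{z, c} \<in> moves n ?E" using legal_move_iff[OF E'] nz' by blast
    moreover have "double_star (insert {z, c} ?E) y c {x, y'} {d, z}"
      using xy xW zW zy z(2) dist c(1) d(2) y'(2) by (auto simp: double_star_def insert_commute)
    ultimately show ?thesis by blast
  next
    case False
    then have yl: "w = y'" if "{y, w} \<in> E" for w using that by blast
    have y'l: "w = y" if w: "{y', w} \<in> E" for w
    proof (rule ccontr)
      assume wy: "w \<noteq> y"
      have wy': "w \<noteq> y'" using legal_positionD(5)[OF E(1) w] by simp
      have "w \<in> \<Union>M" using w M(3) by blast
      then obtain d where d: "{w, d} \<in> M" "{w, d} \<in> E" "w \<noteq> d" using covered_obtain[OF M(1) E(1)] by metis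
      have "distinct [y', y, w, d]" using matching_distinct[OF E(1) M(1,2) y'(1) d(1) wy wy'] .
      moreover have "x \<noteq> w" "x \<noteq> d" using nx d(2) by auto
      ultimately show False
        using p5freeD[OF pf, of x y y' w d] xy w d(2) y'(2) by auto
    qed
    \<comment> \<open>Here \<open>y y'\<close> was a component of its own, and Max's reply produces
      the path \<open>x y y' z\<close>.\<close>
    let ?W = "{x, y, y', z}"
    let ?F = "insert {y', z} ?E"
    have closedE: "b \<in> ?W" if "{a, b} \<in> E" "a \<in> ?W" for a b
      using that nx(1) nz(1) yl y'l by blast
    have closed: "b \<in> ?W" if "{a, b} \<in> ?E" "a \<in> ?W" for a b
      using that closedE[of a b] by (auto simp: doubleton_eq_iff)
    have closed': "b \<in> ?W" if "{a, b} \<in> ?F" "a \<in> ?W" for a b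
      using that closedE[of a b] by (auto simp: doubleton_eq_iff)
    have dist: "distinct [x, y, y', z]" using xy y'(3) zy z(2) by auto
    have F: "legal_position n ?F"
    proof (rule legal_inside_closed[OF E', of ?W])
      show "b \<in> ?W" if "{a, b} \<in> ?E" "a \<in> ?W" for a b using closed that .
    qed (use zn yn zy in \<open>auto simp: card_insert_if\<close>)
    have "leaf_nbrs_small ?F"
    proof (rule leaf_nbrs_small_local[OF E(2), of _ ?W])
      show "b \<in> ?W" if "{a, b} \<in> ?F" "a \<in> ?W" for a b using closed' that .
      have nb: "w = y" if "{x, w} \<in> ?F" for w using that nx(1)[of w] dist by (auto simp: doubleton_eq_iff)
      have nb': "w = x \<or> w = y'" if "{y, w} \<in> ?F" for w using that yl[of w] dist by (auto simp: doubleton_eq_iff)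
      have nb'': "w = y \<or> w = z" if "{y', w} \<in> ?F" for w using that y'l[of w] dist by (auto simp: doubleton_eq_iff)
      have nb''': "w = y'" if "{z, w} \<in> ?F" for w using that nz(1)[of w] dist by (auto simp: doubleton_eq_iff)
      have yF: "{y, x} \<in> ?F" "{y, y'} \<in> ?F" "{y', y} \<in> ?F" "{y', z} \<in> ?F" using y'(2) by (auto simp: insert_commute)
      show "p = q" if l: "l \<in> ?W" "leaf_at ?F l v" and pq: "{v, p} \<in> ?F" "{v, q} \<in> ?F" "p \<noteq> l" "q \<noteq> l" for l v p q
      proof -
        note lv = leaf_atD[OF l(2)]
        have "l \<noteq> y" using lv(1)[of x] lv(1)[of y'] yF(1,2) xy(2) by metis
        moreover have "l \<noteq> y'" using lv(1)[of y] lv(1)[of z] yF(3,4) zy(1) by metis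
        ultimately consider "l = x" | "l = z" using l(1) by blast
        then show ?thesis
        proof cases
          case 1
          then have "v = y" using nb[of v] lv(2) by metis
          then show ?thesis using nb'[of p] nb'[of q] pq 1 by metis
        next
          case 2
          then have "v = y'" using nb'''[of v] lv(2) by metis
          then show ?thesis using nb''[of p] nb''[of q] pq 2 by metis
        qed
      qed
    qed auto
    moreover have "\<exists>M'. M' \<subseteq> ?F \<and> matching M' \<and> \<Union>M' = \<Union>?F"
    proof (intro exI conjI)
      \<comment> \<open>The old matching edge \<open>y y'\<close> is now the middle edge of the path
        and is exchanged for the two outer edges.\<close>
      let ?M = "insert {y', z} (insert {x, y} (M - {{y, y'}}))"
      show "?M \<subseteq> ?F" using M(1) by blast
      have out: "y \<notin> \<Union>(M - {{y, y'}})" "y' \<notin> \<Union>(M - {{y, y'}})"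
      proof -
        have no: "w = y'" if "{y, w} \<in> M" for w using matchingD[OF M(2) that y'(1)] .
        have no': "w = y" if "{y', w} \<in> M" for w using matchingD[OF M(2) that, of y] y'(1) by (simp add: insert_commute)
        have s: "M - {{y, y'}} \<subseteq> E" using M(1) by blast
        show "y \<notin> \<Union>(M - {{y, y'}})"
        proof
          assume "y \<in> \<Union>(M - {{y, y'}})"
          then obtain w where "{y, w} \<in> M - {{y, y'}}" using covered_obtain[OF s E(1)] by metis
          then show False using no by blast
        qed
        show "y' \<notin> \<Union>(M - {{y, y'}})"
        proof
          assume "y' \<in> \<Union>(M - {{y, y'}})"
          then obtain w where "{y', w} \<in> M - {{y, y'}}" using covered_obtain[OF s E(1)] by metis
          then show False using no'[of w] by (auto simp: insert_commute)
        qed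
      qed
      have xz: "x \<notin> \<Union>M" "z \<notin> \<Union>M" using x z(1) M(3) by (auto simp: isolated_def)
      have m1: "matching (insert {x, y} (M - {{y, y'}}))"
        using matching_subset[OF M(2)] xz out by (intro matching_insert) auto
      show "matching ?M"
        using xz out dist by (intro matching_insert[OF m1]) auto
      show "\<Union>?M = \<Union>?F" using M(3) y'(2) by auto
    qed
    ultimately have "matched_position n ?F" using F by (simp add: matched_position_def)
    moreover have "{y', z} \<in> moves n ?E"
      using legal_move_iff[OF E'] F nz'[of y'] by (simp add: insert_commute)
    ultimately show ?thesis by blast
  qed
qed

text \<open>If Mini completes a triangle with a pendant edge \<open>l\<close>--\<open>v\<close>, Max joins \<open>l\<close> to a further vertex.\<close>

lemma reply_to_inner_edge:
  assumes K: "matched_position n E" and x: "x \<in> \<Union>E" and y: "y \<in> \<Union>E"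
    and E': "legal_position n (insert {x, y} E)" and N: "2 \<le> card (isolated n E)"
  shows "\<exists>e\<in>moves n (insert {x, y} E). matched_position n (insert e (insert {x, y} E))"
proof -
  let ?E = "insert {x, y} E"
  have E: "legal_position n E" "leaf_nbrs_small E" using K by (auto simp: matched_position_def)
  obtain M where M: "M \<subseteq> E" "matching M" "\<Union>M = \<Union>E" using K by (auto simp: matched_position_def)
  have M': "M \<subseteq> ?E" "\<Union>M = \<Union>?E" using M(1,3) x y by auto
  show ?thesis
  proof (cases "leaf_nbrs_small ?E")
    case True
    then have "matched_position n ?E" using matched_positionI[OF E' _ M'(1) M(2) M'(2)] by blast
    moreover have "isolated n ?E = isolated n E" using x y by (auto simp: isolated_def)
    ultimately show ?thesis using matched_position_wait N by metis
  next
    case False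
    then obtain l v p q where lv: "leaf_at ?E l v" and pq: "{v, p} \<in> ?E" "{v, q} \<in> ?E" "p \<noteq> l" "q \<noteq> l" "p \<noteq> q"
      unfolding leaf_nbrs_small_def by blast
    note l = leaf_atD(2,1)[OF lv]
    have "l \<in> \<Union>M" using l(1) M'(2) by blast
    then obtain l' where l': "{l, l'} \<in> M" using covered_obtain[OF M(1) E(1)] by metis
    then have "l' = v" using l(2) M'(1) by blast
    then have vl: "{v, l} \<in> M" using l' by (simp add: insert_commute)
    have "p \<in> \<Union>M" using pq(1) M'(2) by blast
    then obtain p' where p': "{p, p'} \<in> M" using covered_obtain[OF M(1) E(1)] by metis
    note jp = joined_pairs_closed[OF E' M'(1) M(2) vl p' pq(1,3)]
    have "q \<in> \<Union>M" using pq(2) M'(2) by blast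
    \<comment> \<open>A leaf can only be matched to its neighbour, so \<open>v l\<close> is a
      matching edge. The block around it then leaves only the partner of \<open>p\<close> for
      \<open>q\<close>, and \<open>v p q\<close> is a triangle.\<close>
    then have "q \<in> {l, v, p, p'}" using jp[of v q] pq(2) by blast
    moreover have "q \<noteq> v" using legal_positionD(5)[OF E' pq(2)] by simp
    ultimately have q: "q = p'" using pq by blast
    have pv: "p \<noteq> v" using legal_positionD(5)[OF E' pq(1)] by simp
    have dist: "distinct [l, v, p, q]"
      using matching_distinct[OF E' M'(1) M(2) vl p' pv pq(3)] q by simp
    let ?W = "{l, v, p, q}"
    have closed: "b \<in> ?W" if "{a, b} \<in> ?E" "a \<in> ?W" for a b
      using jp[of a b] that q M'(2) by blast
    let ?F = "insert {l, p} ?E"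
    have vn: "l < n" "p < n" using legal_positionD(3)[OF E' l(1)] legal_positionD(4)[OF E' pq(1)] .
    have F: "legal_position n ?F"
    proof (rule legal_inside_closed[OF E', of ?W])
      show "b \<in> ?W" if "{a, b} \<in> ?E" "a \<in> ?W" for a b using closed that .
    qed (use vn dist in \<open>auto simp: card_insert_if\<close>)
    \<comment> \<open>If the new edge were elsewhere, the triangle with its pendant edge would
      already have been present in \<open>E\<close>.\<close>
    have xyW: "{x, y} \<subseteq> ?W"
    proof (rule ccontr)
      assume "\<not> {x, y} \<subseteq> ?W"
      then have "x \<notin> ?W" "y \<notin> ?W" using closed[of x y] closed[of y x] by (auto simp: insert_commute)
      then have "{l, v} \<in> E" "{v, p} \<in> E" "{v, q} \<in> E"
        using l(1) pq(1,2) by (auto simp: doubleton_eq_iff)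
      moreover have "leaf_at E l v" using calculation(1) l(2) by (auto simp: leaf_at_def)
      ultimately show False using leaf_nbrs_smallD[OF E(2)] pq(3-5) by blast
    qed
    have "leaf_nbrs_small ?F"
    proof (rule leaf_nbrs_small_local[OF E(2), of _ ?W])
      show "b \<in> ?W" if "{a, b} \<in> ?F" "a \<in> ?W" for a b
        using that closed[of a b] by (auto simp: doubleton_eq_iff)
      show "e \<subseteq> ?W" if "e \<in> ?F" "e \<notin> E" for e using that xyW by auto
      \<comment> \<open>With \<open>l p\<close> added, each of the four vertices has two neighbours,
        so the component has no leaf left to check.\<close>
      have eF: "{l, v} \<in> ?F" "{l, p} \<in> ?F" "{v, l} \<in> ?F" "{v, p} \<in> ?F" "{p, v} \<in> ?F" "{p, q} \<in> ?F"
        "{q, p} \<in> ?F" "{q, v} \<in> ?F"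
        using l(1) pq(1,2) p' M'(1) q by (auto simp: insert_commute)
      show "a = b" if "k \<in> ?W" "leaf_at ?F k w" "{w, a} \<in> ?F" "{w, b} \<in> ?F" "a \<noteq> k" "b \<noteq> k" for k w a b
      proof -
        note k = leaf_atD(1)[OF that(2)]
        have "k \<noteq> l" using k[of v] k[of p] eF(1,2) dist by auto
        moreover have "k \<noteq> v" using k[of l] k[of p] eF(3,4) dist by auto
        moreover have "k \<noteq> p" using k[of v] k[of q] eF(5,6) dist by auto
        moreover have "k \<noteq> q" using k[of p] k[of v] eF(7,8) dist by auto
        ultimately show ?thesis using that(1) by blast
      qed
    qed blast
    moreover have "\<Union>M = \<Union>?F" using M'(2) \<open>l \<in> \<Union>M\<close> \<open>p \<in> \<Union>M\<close> by auto
    ultimately have "matched_position n ?F"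
      using matched_positionI[OF F _ _ M(2)] M'(1) by (simp add: subset_insertI2)
    moreover have "{l, p} \<in> moves n ?E"
    proof -
      have "{l, p} \<notin> ?E" using l(2)[of p] dist by auto
      then show ?thesis using legal_move_iff[OF E'] F by blast
    qed
    ultimately show ?thesis by blast
  qed
qed

text \<open>Four isolated vertices are asked for because Mini may join two of them, and Max then
  waits by joining two others.\<close>

lemma reply_of_Max:
  assumes K: "matched_position n E" and N: "4 \<le> card (isolated n E)" and e: "e \<in> moves n E"
  shows "\<exists>e'\<in>moves n (insert e E). matched_position n (insert e' (insert e E)) \<or>
    (\<exists>u v A B. double_star (insert e' (insert e E)) u v A B)"
proof -
  have E: "legal_position n E" using K by (simp add: matched_position_def)
  obtain x y where xy: "e = {x, y}" "x < n" "y < n" "x \<noteq> y" "legal_position n (insert {x, y} E)"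
    using move_obtain[OF E e] by metis
  have xy': "legal_position n (insert {y, x} E)" "{y, x} = {x, y}" using xy(5) by (simp_all add: insert_commute)
  have N2: "2 \<le> card (isolated n E)" using N by simp
  consider "x \<in> isolated n E" "y \<in> isolated n E" | "x \<in> isolated n E" "y \<in> \<Union>E"
    | "y \<in> isolated n E" "x \<in> \<Union>E" | "x \<in> \<Union>E" "y \<in> \<Union>E"
    using xy(2,3) unfolding isolated_def by blast
  then show ?thesis
  proof cases
    case 1
    have "2 \<le> card (isolated n (insert {x, y} E))" using card_isolated_insert_le[of n E x y] N by simp
    then show ?thesis
      using matched_position_wait matched_position_add_pair(1)[OF K 1 xy(4)] xy(1) by blast
  next
    case 2
    then show ?thesis using reply_to_attachment[OF K 2 xy(5) N2] xy(1) by simp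
  next
    case 3
    then show ?thesis using reply_to_attachment[OF K 3 xy'(1) N2] xy(1) xy'(2) by simp
  next
    case 4
    then show ?thesis using reply_to_inner_edge[OF K 4 xy(5) N2] xy(1) by blast
  qed
qed

text \<open>\<open>k\<close> is the number of leaves to be added on each side of a double star,
  which starts with at least two on each. The second hypothesis makes the resulting product large
  enough; the third is the bound of \<open>score_ge_of_matching\<close> in case the isolated
  vertices run short first.\<close>

lemma val_MiniP_matched_position:
  assumes "matched_position n E" "2 * c \<le> (2 + k) * (2 + k)"
    "c \<le> 3 * n - (15 * (6 * k + 8) + 6)"
  shows "c \<le> val n MiniP E"
  using assms(1)
proof (induction "card ([{..<n}]\<^bsup>2\<^esup> - E)" arbitrary: E rule: less_induct)
  case less
  note K = less.prems
  have E: "legal_position n E" using K by (simp add: matched_position_def)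
  show ?case
  \<comment> \<open>The \<open>2 * k\<close> leaves need \<open>6 * k\<close> isolated vertices, and
    up to six more may go in Mini's move, the reply creating the double star, and Mini's following
    move.\<close>
  proof (cases "card (isolated n E) < 6 * k + 8")
    case True
    obtain M where M: "M \<subseteq> E" "matching M" "\<Union>M = \<Union>E" using K by (auto simp: matched_position_def)
    obtain E' where E': "E \<subseteq> E'" "legal_position n E'" "moves n E' = {}" "val n MiniP E = score n E'"
      using val_reachable[OF E, of MiniP] by blast
    have "card ({..<n} - \<Union>M) \<le> 6 * k + 8" using True M(3) by (simp add: isolated_def)
    then have "3 * n \<le> score n E' + 15 * (6 * k + 8) + 6"
      using score_ge_of_matching[OF E'(2,3) _ M(2)] M(1) E'(1) by blast
    then show ?thesis using assms(3) E'(4) by linarith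
  next
    case False
    then have N: "6 * k + 8 \<le> card (isolated n E)" by simp
    show ?thesis
    proof (rule val_MiniP_ge)
      have "\<exists>e\<in>moves n E. matched_position n (insert e E)" using matched_position_wait[OF K] N by simp
      then show "c \<le> score n E" if "moves n E = {}" using that by blast
    next
      fix e assume e: "e \<in> moves n E"
      let ?E = "insert e E"
      have E1: "legal_position n ?E" using legal_move_iff[OF E] e by blast
      have N1: "6 * k + 6 \<le> card (isolated n ?E)" using card_isolated_move_le[OF E e] N by linarith
      have "4 \<le> card (isolated n E)" using N by simp
      from reply_of_Max[OF K this e]
      obtain e' where e': "e' \<in> moves n ?E" and cases: "matched_position n (insert e' ?E) \<or>
          (\<exists>u v A B. double_star (insert e' ?E) u v A B)"
        by blast
      let ?F = "insert e' ?E"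
      have E2: "legal_position n ?F" using legal_move_iff[OF E1] e' by blast
      have N2: "6 * k + 4 \<le> card (isolated n ?F)" using card_isolated_move_le[OF E1 e'] N1 by linarith
      have "c \<le> val n MiniP ?F"
        using cases
      proof (elim disjE exE)
        assume "matched_position n ?F"
        then show ?thesis
          using less.hyps card_unclaimed_less[OF e] card_unclaimed_less[OF e'] by (meson less_trans)
      next
        fix u v A B assume ds: "double_star ?F u v A B"
        show ?thesis
        proof (rule val_MiniP_ge)
          have "isolated n ?F \<noteq> {}" using N2 by auto
          then show "c \<le> score n ?F" if "moves n ?F = {}"
            using double_star_attach(2)[OF E2 ds] that by blast
        next
          fix f assume f: "f \<in> moves n ?F"
          have E3: "legal_position n (insert f ?F)" using legal_move_iff[OF E2] f by blast
          have N3: "3 * (k + k) \<le> card (isolated n (insert f ?F))"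
            using card_isolated_move_le[OF E2 f] N2 by simp
          have ds3: "double_star (insert f ?F) u v A B" using double_star_mono[OF ds] by blast
          have "(2 + k) * (2 + k) \<le> (card A + k) * (card B + k)"
            using double_starD(10,11)[OF ds] by (intro mult_le_mono) auto
          also have "\<dots> \<le> 2 * val n MaxP (insert f ?F)" using val_MaxP_double_star[OF E3 ds3 N3] .
          finally show "c \<le> val n MaxP (insert f ?F)" using assms(2) by linarith
        qed
      qed
      then show "c \<le> val n MaxP ?E" using val_MaxP_ge[OF e'] by blast
    qed
  qed
qed

section \<open>Graphs without double stars\<close>

text \<open>A cycle of length at least five contains a P_5, so in the graphs at hand there are no
  cycles other than these two kinds.\<close>

definition on_cycle :: "'a set set \<Rightarrow> 'a \<Rightarrow> bool" where
  "on_cycle E a \<longleftrightarrow>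
     (\<exists>p q. distinct [a, p, q] \<and> {a, p} \<in> E \<and> {p, q} \<in> E \<and> {q, a} \<in> E) \<or>
     (\<exists>p q r. distinct [a, p, q, r] \<and> {a, p} \<in> E \<and> {p, q} \<in> E \<and> {q, r} \<in> E \<and> {r, a} \<in> E)"

lemma on_cycle_mono: "on_cycle E a \<Longrightarrow> E \<subseteq> E' \<Longrightarrow> on_cycle E' a"
  unfolding on_cycle_def by blast

lemma on_cycleE:
  assumes "on_cycle E a"
  obtains p q where "distinct [a, p, q]" "{a, p} \<in> E" "{p, q} \<in> E" "{q, a} \<in> E"
  | p q r where "distinct [a, p, q, r]" "{a, p} \<in> E" "{p, q} \<in> E" "{q, r} \<in> E" "{r, a} \<in> E"
  using assms unfolding on_cycle_def by blast

lemma on_cycleI3: "distinct [a, p, q] \<Longrightarrow> {a, p} \<in> E \<Longrightarrow> {p, q} \<in> E \<Longrightarrow> {q, a} \<in> E \<Longrightarrow> on_cycle E a"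
  unfolding on_cycle_def by blast

lemma on_cycleI4:
  "distinct [a, p, q, r] \<Longrightarrow> {a, p} \<in> E \<Longrightarrow> {p, q} \<in> E \<Longrightarrow> {q, r} \<in> E \<Longrightarrow> {r, a} \<in> E \<Longrightarrow> on_cycle E a"
  unfolding on_cycle_def by blast

text \<open>The consequence shared by both cycle lengths; it is all that is needed to keep leaves
  and centers of double stars off the cycles.\<close>

lemma on_cycle_nbrs:
  assumes "on_cycle E a"
  shows "\<exists>x y x' y'. x \<noteq> y \<and> {a, x} \<in> E \<and> {a, y} \<in> E \<and> {x, x'} \<in> E \<and> {y, y'} \<in> E \<and> x' \<noteq> a \<and> y' \<noteq> a"
  using assms
proof (cases rule: on_cycleE)
  case (1 p q)
  show ?thesis
    by (rule exI[of _ p], rule exI[of _ q], rule exI[of _ q], rule exI[of _ p])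
      (use 1 in \<open>auto simp: insert_commute\<close>)
next
  case (2 p q r)
  show ?thesis
    by (rule exI[of _ p], rule exI[of _ r], rule exI[of _ q], rule exI[of _ q])
      (use 2 in \<open>auto simp: insert_commute\<close>)
qed

lemma leaf_not_on_cycle:
  assumes "leaf_at E l v"
  shows "\<not> on_cycle E l"
proof
  assume "on_cycle E l"
  from on_cycle_nbrs[OF this] leaf_atD(1)[OF assms] show False by metis
qed

lemma double_star_leaf_at:
  assumes "legal_position n E" "double_star E u v A B" "a \<in> A"
  shows "leaf_at E a u"
  unfolding leaf_at_def
  using double_star_leaf[OF legal_positionD(2)[OF assms(1)] assms(2,3)] legal_positionD(5)[OF assms(1)]
    double_starD(8)[OF assms(2,3)] by blast

text \<open>A cycle through \<open>u\<close> contains a neighbour \<open>t\<close> other than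
  \<open>v\<close> that has a further neighbour. But \<open>t\<close> could be added to
  \<open>A\<close>, and then it would have to be a leaf.\<close>

lemma double_star_center_not_on_cycle:
  assumes E: "legal_position n E" and ds: "double_star E u v A B"
  shows "\<not> on_cycle E u"
proof
  assume "on_cycle E u"
  then obtain t t' where t: "{u, t} \<in> E" "t \<noteq> v" "{t, t'} \<in> E" "t' \<noteq> u"
    using on_cycle_nbrs[of E u] by metis
  note d = double_starD[OF ds]
  have "t \<notin> B"
  proof
    assume "t \<in> B"
    from leaf_atD(1)[OF double_star_leaf_at[OF E double_star_sym[OF ds] this], of u] t(1) d(2)
    show False by (simp add: insert_commute)
  qed
  moreover have "t \<noteq> u" using legal_positionD(5)[OF E t(1)] by simp
  moreover have "2 \<le> card (insert t A)" using d(10,12) by (simp add: card_insert_if)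
  ultimately have "double_star E u v (insert t A) B"
    using ds t(1,2) by (auto simp: double_star_def insert_commute)
  from leaf_atD(1)[OF double_star_leaf_at[OF E this, of t] t(3)] show False using t(4) by simp
qed

definition ends_on_cycles :: "'a set set \<Rightarrow> bool" where
  "ends_on_cycles E \<longleftrightarrow> (\<forall>b x y. {b, x} \<in> E \<longrightarrow> {b, y} \<in> E \<longrightarrow> x \<noteq> y \<longrightarrow> on_cycle E b)"

text \<open>Unlike \<open>ends_on_cycles\<close>, the following condition survives arbitrary further moves.\<close>

definition nearly_settled :: "nat \<Rightarrow> nat set set \<Rightarrow> bool" where
  "nearly_settled n E \<longleftrightarrow> (\<exists>M s. M \<subseteq> E \<and> matching M \<and>
     (\<forall>v<n. v = s \<or> v \<in> \<Union>M \<or> on_cycle E v \<or> (\<exists>w. {v, w} \<in> E \<and> on_cycle E w)))"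

lemma nearly_settled_mono:
  assumes "nearly_settled n E" "E \<subseteq> E'"
  shows "nearly_settled n E'"
proof -
  obtain M s where M: "M \<subseteq> E" "matching M"
    "\<And>v. v < n \<Longrightarrow> v = s \<or> v \<in> \<Union>M \<or> on_cycle E v \<or> (\<exists>w. {v, w} \<in> E \<and> on_cycle E w)"
    using assms(1) unfolding nearly_settled_def by blast
  have "v = s \<or> v \<in> \<Union>M \<or> on_cycle E' v \<or> (\<exists>w. {v, w} \<in> E' \<and> on_cycle E' w)" if "v < n" for v
    using M(3)[OF that] on_cycle_mono[OF _ assms(2)] assms(2) by blast
  then show ?thesis using M(1,2) assms(2) unfolding nearly_settled_def by (meson subset_trans)
qed

lemma ends_on_cycles_no_double_star:
  assumes "legal_position n E" "ends_on_cycles E"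
  shows "\<not> double_star E u v A B"
proof
  assume ds: "double_star E u v A B"
  note d = double_starD[OF ds]
  obtain a where a: "a \<in> A" using d(10) by fastforce
  have "{u, v} \<in> E" "{u, a} \<in> E" "a \<noteq> v" using d(1) d(8)[OF a] d(5) a by (auto simp: insert_commute)
  then have "on_cycle E u" using assms(2) unfolding ends_on_cycles_def by blast
  then show False using double_star_center_not_on_cycle[OF assms(1) ds] by blast
qed

text \<open>A leaf of a double star is not on a cycle, and neither is the center it hangs at. So it
  is \<open>s\<close> or matched to its center. Two leaves cannot be matched to one center, hence
  \<open>s\<close> lies in \<open>A\<close> and, by symmetry, in \<open>B\<close>, although these
  are disjoint.\<close>

lemma nearly_settled_no_double_star:
  assumes E: "legal_position n E" and Y: "nearly_settled n E"
  shows "\<not> double_star E u v A B"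
proof
  assume ds: "double_star E u v A B"
  obtain M s where M: "M \<subseteq> E" "matching M"
    "\<And>x. x < n \<Longrightarrow> x = s \<or> x \<in> \<Union>M \<or> on_cycle E x \<or> (\<exists>w. {x, w} \<in> E \<and> on_cycle E w)"
    using Y unfolding nearly_settled_def by blast
  have s: "s \<in> A" if ds: "double_star E u v A B" for u v A B
  proof (rule ccontr)
    assume sA: "s \<notin> A"
    have m: "{u, a} \<in> M" if a: "a \<in> A" for a
    proof -
      note leaf = double_star_leaf_at[OF E ds a]
      have "a < n" using legal_positionD(3)[OF E leaf_atD(2)[OF leaf]] .
      moreover have "\<not> (\<exists>w. {a, w} \<in> E \<and> on_cycle E w)"
        using double_star_center_not_on_cycle[OF E ds] leaf_atD(1)[OF leaf] by blast
      ultimately have "a \<in> \<Union>M" using M(3)[of a] leaf_not_on_cycle[OF leaf] sA a by blast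
      then obtain a' where "{a, a'} \<in> M" "{a, a'} \<in> E" using covered_obtain[OF M(1) E] by metis
      then show ?thesis using leaf_atD(1)[OF leaf] by (metis insert_commute)
    qed
    obtain a where a: "a \<in> A" using double_starD(10)[OF ds] by fastforce
    obtain a' where "a' \<in> A" "a' \<noteq> a" using ex_other_mem[OF double_starD(10)[OF ds]] by blast
    then show False using matchingD[OF M(2) m[OF a] m] by blast
  qed
  show False using s[OF ds] s[OF double_star_sym[OF ds]] double_starD(7)[OF ds] by blast
qed

section \<open>Counting copies of P_4 at their ends\<close>

lemma P4_from_iff:
  "xs \<in> P4_from E a \<longleftrightarrow> (\<exists>p q r. xs = [a, p, q, r] \<and> distinct [a, p, q, r] \<and>
     {a, p} \<in> E \<and> {p, q} \<in> E \<and> {q, r} \<in> E)"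
  unfolding P4_from_def P4_lists_def by auto

text \<open>With a further vertex \<open>z\<close> at \<open>b\<close>, only
  \<open>[a, b, c, d]\<close> and \<open>[a, b, d, c]\<close> can start at \<open>a\<close>. The
  decisive case is a second continuation \<open>r\<close> at \<open>c\<close>: then \<open>b\<close>
  and \<open>c\<close> would be centers with leaves \<open>a\<close>, \<open>z\<close> and
  \<open>d\<close>, \<open>r\<close>.\<close>

lemma card_P4_from_pendant:
  assumes pf: "p5free E" and nods: "\<And>A B. \<not> double_star E b c A B"
    and dist: "distinct [a, b, c, d, z]"
    and e: "{a, b} \<in> E" "{b, c} \<in> E" "{c, d} \<in> E" "{z, b} \<in> E"
  shows "card (P4_from E a) \<le> 3"
proof -
  have "P4_from E a \<subseteq> {[a, b, c, d], [a, b, d, c]}"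
  proof
    fix xs assume "xs \<in> P4_from E a"
    then obtain p q r where xs: "xs = [a, p, q, r]" "distinct [a, p, q, r]" "{a, p} \<in> E" "{p, q} \<in> E" "{q, r} \<in> E"
      unfolding P4_from_iff by blast
    have p: "p = b"
    proof (rule ccontr)
      assume "p \<noteq> b"
      then show False
        using p5freeD[OF pf, of z b a c d] p5freeD[OF pf, of z b a d c] p5freeD[OF pf, of p a b c d]
          xs(2,3) dist e by (auto simp: insert_commute)
    qed
    have q: "q = c \<or> q = d"
    proof (rule ccontr)
      assume nq: "\<not> (q = c \<or> q = d)"
      have "r \<noteq> c" using p5freeD[OF pf, of a b q c d] nq xs(2,4,5) p dist e by auto
      moreover have "r \<noteq> d"
        using p5freeD[OF pf, of a b q d c] nq xs(2,4,5) p dist e by (auto simp: insert_commute)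
      ultimately show False
        using p5freeD[OF pf, of r q b c d] nq xs(2,4,5) p dist e by (auto simp: insert_commute)
    qed
    have "q = d \<Longrightarrow> r = c"
      using p5freeD[OF pf, of a b c d r] xs(2,5) p dist e by auto
    moreover have "r = d" if "q = c"
    proof (rule ccontr)
      assume rd: "r \<noteq> d"
      have rc: "{r, c} \<in> E" using xs(5) that by (simp add: insert_commute)
      have "r \<noteq> z" using p5freeD[OF pf, of a b z c d] rc dist e by (auto simp: insert_commute)
      then have "double_star E b c {a, z} {d, r}"
        using rc xs(2) p that dist e rd by (auto simp: double_star_def insert_commute)
      then show False using nods by blast
    qed
    ultimately show "xs \<in> {[a, b, c, d], [a, b, d, c]}" using q p xs(1) by auto
  qed
  from card_mono[OF _ this] show ?thesis using dist by simp
qed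

lemma card_P4_from_closed:
  assumes dist: "distinct [a, b, c, d]"
    and closed: "\<And>x y. {x, y} \<in> E \<Longrightarrow> x \<in> {a, b, c, d} \<Longrightarrow> y \<in> {a, b, c, d}"
  shows "card (P4_from E a) \<le> 6"
proof -
  let ?L = "{[a, b, c, d], [a, b, d, c], [a, c, b, d], [a, c, d, b], [a, d, b, c], [a, d, c, b]}"
  have "P4_from E a \<subseteq> ?L"
  proof
    fix xs assume "xs \<in> P4_from E a"
    then obtain p q r where xs: "xs = [a, p, q, r]" "distinct [a, p, q, r]" "{a, p} \<in> E" "{p, q} \<in> E" "{q, r} \<in> E"
      unfolding P4_from_iff by blast
    have "p \<in> {a, b, c, d}" using closed[OF xs(3)] by simp
    moreover from closed[OF xs(4) this] have "q \<in> {a, b, c, d}" .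
    moreover from closed[OF xs(5) this] have "r \<in> {a, b, c, d}" .
    ultimately show "xs \<in> ?L" using xs(1,2) by auto
  qed
  from card_mono[OF _ this] show ?thesis using dist by simp
qed

text \<open>A fifth vertex in the component must hang at an inner vertex of the path, and then few
  lists start at the end next to it. Without a fifth vertex there are only 3! lists from each
  end.\<close>

lemma P4_ends_small:
  assumes E: "legal_position n E" and nods: "\<And>u v A B. \<not> double_star E u v A B"
    and P: "[a, b, c, d] \<in> P4_lists E"
  shows "card (P4_from E a) \<le> 3 \<or> card (P4_from E d) \<le> 3 \<or> card (P4_from E a) \<le> 6 \<and> card (P4_from E d) \<le> 6"
proof -
  have dist: "distinct [a, b, c, d]" and e: "{a, b} \<in> E" "{b, c} \<in> E" "{c, d} \<in> E"
    using P by (auto simp: P4_lists_def)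
  have e': "{d, c} \<in> E" "{c, b} \<in> E" "{b, a} \<in> E" using e by (simp_all add: insert_commute)
  note pf = legal_positionD(2)[OF E]
  show ?thesis
  proof (cases "\<exists>x\<in>{a, b, c, d}. \<exists>z. {x, z} \<in> E \<and> z \<notin> {a, b, c, d}")
    case True
    then obtain x z where xz: "x \<in> {a, b, c, d}" "{x, z} \<in> E" "z \<notin> {a, b, c, d}" by blast
    then have z: "x \<in> {a, b, c, d}" "{z, x} \<in> E" "z \<notin> {a, b, c, d}" by (simp_all add: insert_commute)
    have "x \<noteq> a" using p5freeD[OF pf _ e, of z] z dist by auto
    moreover have "x \<noteq> d" using p5freeD[OF pf _ e', of z] z dist by auto
    ultimately consider "x = b" | "x = c" using z(1) by blast
    then show ?thesis
    proof cases
      case 1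
      then show ?thesis using card_P4_from_pendant[OF pf nods _ e, of z] z dist by auto
    next
      case 2
      then show ?thesis using card_P4_from_pendant[OF pf nods _ e', of z] z dist by auto
    qed
  next
    case False
    have closed: "y \<in> {a, b, c, d}" if "{x, y} \<in> E" "x \<in> {a, b, c, d}" for x y using that False by blast
    have W: "{d, c, b, a} = {a, b, c, d}" by blast
    have dist': "distinct [d, c, b, a]" using dist by auto
    have "card (P4_from E a) \<le> 6" using card_P4_from_closed[OF dist] closed by blast
    moreover have "card (P4_from E d) \<le> 6"
    proof (rule card_P4_from_closed[OF dist'])
      show "y \<in> {d, c, b, a}" if "{x, y} \<in> E" "x \<in> {d, c, b, a}" for x y
        using closed[of x y] that unfolding W by simp
    qed
    ultimately show ?thesis by blast
  qed
qed

lemma rev_P4: "[a, b, c, d] \<in> P4_lists E \<Longrightarrow> [d, c, b, a] \<in> P4_lists E"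
  by (auto simp: P4_lists_def insert_commute)

text \<open>Each list is charged to one of its ends. A vertex of \<open>L\<close> pays for the lists
  starting and for those ending there, a vertex of \<open>K\<close> only for those starting there,
  so nobody pays more than six. A vertex where many lists start, such as a triangle vertex opposite
  to many pendant edges, pays nothing: the other ends of its lists are in \<open>L\<close>.\<close>

lemma score_le:
  assumes E: "legal_position n E" and nods: "\<And>u v A B. \<not> double_star E u v A B"
  shows "score n E \<le> 3 * n"
proof -
  let ?f = "\<lambda>x. card (P4_from E x)"
  define L where "L = {x \<in> {..<n}. ?f x \<le> 3}"
  define K where "K = {x \<in> {..<n}. 3 < ?f x \<and> ?f x \<le> 6}"
  have fin: "finite L" "finite K" by (simp_all add: L_def K_def)
  have finP: "finite (P4_lists E)" using finite_P4_lists[OF legal_positionD(1)[OF E]] .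
  have finF: "finite (P4_from E x)" for x using finP by (simp add: P4_from_def)
  let ?A = "\<Union>x\<in>L. P4_from E x" and ?B = "\<Union>x\<in>K. P4_from E x"
  have sub: "P4_lists E \<subseteq> ?A \<union> rev ` ?A \<union> ?B"
  proof
    fix xs assume xs: "xs \<in> P4_lists E"
    then obtain a b c d where abcd: "xs = [a, b, c, d]" "{a, b} \<in> E" "{c, d} \<in> E"
      unfolding P4_lists_def by blast
    have n: "a < n" "d < n" using legal_positionD(3)[OF E abcd(2)] legal_positionD(4)[OF E abcd(3)] .
    have a: "xs \<in> P4_from E a" using xs abcd(1) by (simp add: P4_from_def)
    have "[d, c, b, a] \<in> P4_from E d" using rev_P4 xs abcd(1) by (simp add: P4_from_def)
    moreover have "xs = rev [d, c, b, a]" using abcd(1) by simp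
    ultimately have d: "xs \<in> rev ` P4_from E d" by blast
    have "a \<in> L \<or> d \<in> L \<or> a \<in> K"
      using P4_ends_small[OF E nods, of a b c d] xs abcd(1) n by (auto simp: L_def K_def)
    then show "xs \<in> ?A \<union> rev ` ?A \<union> ?B" using a d by blast
  qed
  have A: "card ?A \<le> 3 * card L"
  proof -
    have "card ?A \<le> (\<Sum>x\<in>L. ?f x)" using fin by (intro card_UN_le)
    also have "\<dots> \<le> 3 * card L" using sum_bounded_above[of L ?f 3] by (simp add: L_def mult.commute)
    finally show ?thesis .
  qed
  have B: "card ?B \<le> 6 * card K"
  proof -
    have "card ?B \<le> (\<Sum>x\<in>K. ?f x)" using fin by (intro card_UN_le)
    also have "\<dots> \<le> 6 * card K" using sum_bounded_above[of K ?f 6] by (simp add: K_def mult.commute)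
    finally show ?thesis .
  qed
  have finA: "finite ?A" "finite ?B" using fin finF by blast+
  have "card (P4_lists E) \<le> card (?A \<union> rev ` ?A \<union> ?B)" using finA sub by (intro card_mono) auto
  also have "\<dots> \<le> card ?A + card (rev ` ?A) + card ?B"
    using card_Un_le[of "?A \<union> rev ` ?A" ?B] card_Un_le[of ?A "rev ` ?A"] by linarith
  also have "\<dots> \<le> 6 * card L + 6 * card K" using A B card_image_le[OF finA(1), of rev] by linarith
  also have "\<dots> = 6 * card (L \<union> K)"
    using fin by (subst card_Un_disjoint) (auto simp: L_def K_def)
  also have "\<dots> \<le> 6 * n" using card_mono[of "{..<n}" "L \<union> K"] by (auto simp: L_def K_def)
  finally show ?thesis using card_P4_lists[OF legal_positionD(1)[OF E]] by simp
qed

lemma nearly_settled_val_le: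
  assumes "legal_position n E" "nearly_settled n E"
  shows "val n p E \<le> 3 * n"
proof -
  obtain E' where E': "E \<subseteq> E'" "legal_position n E'" "val n p E = score n E'"
    using val_reachable[OF assms(1), of p] by blast
  have "\<not> double_star E' u v A B" for u v A B
    using nearly_settled_no_double_star[OF E'(2) nearly_settled_mono[OF assms(2) E'(1)]] .
  from score_le[OF E'(2) this] show ?thesis using E'(3) by simp
qed

section \<open>Mini's strategy\<close>

lemma ends_on_cyclesD: "ends_on_cycles E \<Longrightarrow> {b, x} \<in> E \<Longrightarrow> {b, y} \<in> E \<Longrightarrow> x \<noteq> y \<Longrightarrow> on_cycle E b"
  unfolding ends_on_cycles_def by blast

lemma ends_on_cyclesI: "(\<And>b x y. {b, x} \<in> E \<Longrightarrow> {b, y} \<in> E \<Longrightarrow> x \<noteq> y \<Longrightarrow> on_cycle E b) \<Longrightarrow> ends_on_cycles E"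
  unfolding ends_on_cycles_def by blast

lemma ends_on_cycles_local:
  assumes E: "ends_on_cycles E" "E \<subseteq> E'" and out: "\<And>e. e \<in> E' \<Longrightarrow> e \<notin> E \<Longrightarrow> e \<subseteq> W"
    and W: "\<And>x. x \<in> W \<Longrightarrow> on_cycle E' x"
  shows "ends_on_cycles E'"
proof (rule ends_on_cyclesI)
  fix b x y assume b: "{b, x} \<in> E'" "{b, y} \<in> E'" "x \<noteq> y"
  show "on_cycle E' b"
  proof (cases "b \<in> W")
    case False
    then have "{b, x} \<in> E" "{b, y} \<in> E" using out[OF b(1)] out[OF b(2)] by auto
    then show ?thesis using ends_on_cyclesD[OF E(1)] on_cycle_mono[OF _ E(2)] b(3) by blast
  qed (rule W)
qed

lemma ends_on_cycles_add_pair: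
  assumes "legal_position n E" "ends_on_cycles E" and x: "x \<in> isolated n E" and y: "y \<in> isolated n E" and "x \<noteq> y"
  shows "{x, y} \<in> moves n E" "ends_on_cycles (insert {x, y} E)"
proof -
  note nx = isolated_no_edge[OF x] and ny = isolated_no_edge[OF y]
  have "legal_position n (insert {x, y} E)"
  proof (rule legal_inside_closed[OF assms(1), of "{x, y}"])
    show "b \<in> {x, y}" if "{a, b} \<in> E" "a \<in> {x, y}" for a b using that nx ny by blast
  qed (use x y \<open>x \<noteq> y\<close> in \<open>auto simp: isolated_def\<close>)
  then show "{x, y} \<in> moves n E" using legal_move_iff[OF assms(1)] nx by blast
  show "ends_on_cycles (insert {x, y} E)"
  proof (rule ends_on_cyclesI)
    fix b s t assume b: "{b, s} \<in> insert {x, y} E" "{b, t} \<in> insert {x, y} E" "s \<noteq> t"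
    have "b \<noteq> x" using b nx(1)[of s] nx(1)[of t] by (auto simp: doubleton_eq_iff)
    moreover have "b \<noteq> y" using b ny(1)[of s] ny(1)[of t] by (auto simp: doubleton_eq_iff)
    ultimately have "{b, s} \<in> E" "{b, t} \<in> E" using b(1,2) by (auto simp: doubleton_eq_iff)
    then show "on_cycle (insert {x, y} E) b"
      using ends_on_cyclesD[OF assms(2)] on_cycle_mono[of E] b(3) by blast
  qed
qed

text \<open>While two isolated vertices exist, joining them is a waiting move. Otherwise the
  position is settled: a vertex of an edge that is no component by itself has degree at least two or
  a neighbour of degree at least two, and that vertex is on a cycle.\<close>

lemma ends_on_cycles_wait:
  assumes E: "legal_position n E" and J: "ends_on_cycles E"
  shows "nearly_settled n E \<or> (\<exists>e\<in>moves n E. ends_on_cycles (insert e E))"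
proof (cases "\<exists>x y. x \<in> isolated n E \<and> y \<in> isolated n E \<and> x \<noteq> y")
  case True
  then show ?thesis using ends_on_cycles_add_pair[OF E J] by blast
next
  case False
  then obtain s where s: "isolated n E \<subseteq> {s}" by blast
  \<comment> \<open>The edges that are components of their own.\<close>
  define M where "M = {{x, y} | x y. leaf_at E x y \<and> leaf_at E y x}"
  have "M \<subseteq> E" unfolding M_def by (auto simp: leaf_at_def)
  moreover have "matching M"
    unfolding matching_def
  proof (intro allI impI)
    have l: "leaf_at E x y" if "{x, y} \<in> M" for x y
      using that unfolding M_def mem_Collect_eq doubleton_eq_iff by metis
    fix x y z assume "{x, y} \<in> M" "{x, z} \<in> M"
    from leaf_atD(1)[OF l[OF this(2)] leaf_atD(2)[OF l[OF this(1)]]] show "y = z" .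
  qed
  moreover have "v = s \<or> v \<in> \<Union>M \<or> on_cycle E v \<or> (\<exists>w. {v, w} \<in> E \<and> on_cycle E w)" if v: "v < n" for v
  proof (cases "v \<in> isolated n E")
    case False
    then obtain w where w: "{v, w} \<in> E" using isolated_iff[OF E] v by blast
    have wv: "{w, v} \<in> E" using w by (simp add: insert_commute)
    show ?thesis
    proof (cases "leaf_at E v w \<and> leaf_at E w v")
      case True
      then have "v \<in> \<Union>M" unfolding M_def by blast
      then show ?thesis by blast
    next
      case False
      then obtain t where "{v, t} \<in> E \<and> t \<noteq> w \<or> {w, t} \<in> E \<and> t \<noteq> v"
        using w wv unfolding leaf_at_def by blast
      then show ?thesis using ends_on_cyclesD[OF J] w wv by metis
    qed
  qed (use s in blast)
  ultimately show ?thesis unfolding nearly_settled_def by blast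
qed

text \<open>If Max creates a vertex \<open>b\<close> of degree 2 off the cycles, then the component of \<open>b\<close> is a path
  on three or four vertices; Mini closes it to a cycle.\<close>

lemma reply_close_cycle:
  assumes E: "legal_position n E" and J: "ends_on_cycles E" and E': "legal_position n (insert {b, c} E)"
    and ba: "{b, a} \<in> E" "a \<noteq> c" and new: "{b, c} \<notin> E" and off: "\<not> on_cycle (insert {b, c} E) b"
  shows "\<exists>e\<in>moves n (insert {b, c} E). ends_on_cycles (insert e (insert {b, c} E))"
proof -
  let ?E = "insert {b, c} E"
  note pf = legal_positionD(2)[OF E']
  have mono: "on_cycle ?E x" if "on_cycle E x" for x using on_cycle_mono[OF that] by blast
  have bn: "\<not> on_cycle E b" using off mono by blast
  have bc: "b \<noteq> c" "b \<noteq> a" using legal_positionD(5)[OF E', of b c] legal_positionD(5)[OF E ba(1)] by auto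
  have new': "{c, b} \<notin> E" using new by (simp add: insert_commute)
  have cb: "{c, b} \<in> ?E" by (simp add: insert_commute)
  have ab: "{a, b} \<in> E" using ba(1) by (simp add: insert_commute)
  have b_nbr: "x = a" if "{b, x} \<in> E" for x using ends_on_cyclesD[OF J ba(1) that] bn by blast
  have nb: "x = a" if "{x, b} \<in> E" for x using b_nbr[of x] that by (simp add: insert_commute)
  \<comment> \<open>With a second neighbour, \<open>a\<close> would be on a cycle through some
    \<open>p\<close> and \<open>q\<close>, and \<open>c b a p q\<close> would be a path. If
    \<open>c\<close> coincided with one of the vertices on it, the edge \<open>b c\<close> would
    have put \<open>b\<close> on a cycle.\<close>
  have a_nbr: "x = b" if ax: "{a, x} \<in> E" for x
  proof (rule ccontr)
    assume "x \<noteq> b"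
    then have "on_cycle E a" using ends_on_cyclesD[OF J ab ax] by blast
    then show False
    proof (cases rule: on_cycleE)
      case (1 p q)
      have ne: "p \<noteq> b" "q \<noteq> b" using 1 b_nbr[of q] b_nbr[of a] nb[of p] by auto
      have "c \<noteq> p" using off on_cycleI3[of b c a ?E] 1 ab bc ba(2) by (auto simp: insert_commute)
      moreover have "c \<noteq> q" using off on_cycleI3[of b c a ?E] 1 ab bc ba(2) by (auto simp: insert_commute)
      ultimately show False using p5freeD[OF pf cb, of a p q] ba 1 ne bc by auto
    next
      case (2 p q r)
      have ne: "p \<noteq> b" "q \<noteq> b" using 2 b_nbr[of q] b_nbr[of r] by auto
      have "c \<noteq> p" using off on_cycleI3[of b c a ?E] 2 ab bc ba(2) by (auto simp: insert_commute)
      moreover have "c \<noteq> q"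
        using off on_cycleI4[of b c p a ?E] 2 ab bc ba(2) ne by (auto simp: insert_commute)
      ultimately show False using p5freeD[OF pf cb, of a p q] ba 2 ne bc by auto
    qed
  qed
  have na: "x = b" if "{x, a} \<in> E" for x using a_nbr[of x] that by (simp add: insert_commute)
  have lt: "a < n" "b < n" "c < n"
    using legal_positionD(3,4)[OF E ba(1)] legal_positionD(4)[OF E', of b c] by auto
  show ?thesis
  proof (cases "\<exists>d. {c, d} \<in> E")
    case False
    \<comment> \<open>\<open>c\<close> was isolated, so the component is the path
      \<open>a b c\<close>; Mini closes the triangle.\<close>
    let ?W = "{a, b, c}" and ?F = "insert {a, c} ?E"
    have closed: "y \<in> ?W" if "{x, y} \<in> ?E" "x \<in> ?W" for x y
    proof (cases "{x, y} \<in> E")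
      case True
      then show ?thesis using that(2) a_nbr b_nbr False by blast
    qed (use that in auto)
    have F: "legal_position n ?F"
    proof (rule legal_inside_closed[OF E', of ?W])
      show "y \<in> ?W" if "{x, y} \<in> ?E" "x \<in> ?W" for x y using closed that .
    qed (use lt ba(2) in \<open>auto simp: card_insert_if\<close>)
    have "ends_on_cycles ?F"
    proof (rule ends_on_cycles_local[OF J, of _ ?W])
      fix x assume "x \<in> ?W"
      then show "on_cycle ?F x"
        using on_cycleI3[of a b c ?F] on_cycleI3[of b c a ?F] on_cycleI3[of c a b ?F] ab bc ba(2)
        by (auto simp: insert_commute)
    qed auto
    moreover have "{a, c} \<notin> ?E" using a_nbr[of c] bc by (auto simp: doubleton_eq_iff)
    ultimately show ?thesis using legal_move_iff[OF E'] F by blast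
  next
    case True
    then obtain d where cd: "{c, d} \<in> E" by blast
    have dc: "{d, c} \<in> E" using cd by (simp add: insert_commute)
    have dne: "d \<noteq> c" "d \<noteq> b" "d \<noteq> a"
      using legal_positionD(5)[OF E cd] cd nb[of c] na[of c] ba(2) bc(1) by auto
    have ab': "{a, b} \<in> ?E" "{b, c} \<in> ?E" using ab by simp_all
    \<comment> \<open>A cycle through \<open>c\<close> in \<open>E\<close> avoids \<open>a\<close>
      and \<open>b\<close>, whose only neighbours there are each other, so it would yield the path
      \<open>a b c p q\<close>.\<close>
    have c_nbr: "x = d" if cx: "{c, x} \<in> E" for x
    proof (rule ccontr)
      assume "x \<noteq> d"
      then have "on_cycle E c" using ends_on_cyclesD[OF J cd cx] by blast
      then obtain p q where pq: "distinct [c, p, q]" "{c, p} \<in> E" "{p, q} \<in> E"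
        unfolding on_cycle_def by auto
      have "p \<noteq> a" "p \<noteq> b" using pq(2) na[of c] nb[of c] bc ba(2) by auto
      moreover from this have "q \<noteq> a" "q \<noteq> b" using pq(3) na[of p] nb[of p] by auto
      ultimately show False using p5freeD[OF pf ab', of p q] pq bc ba(2) by auto
    qed
    have nc: "x = d" if "{x, c} \<in> E" for x using c_nbr[of x] that by (simp add: insert_commute)
    have d_nbr: "x = c" if dx: "{d, x} \<in> E" for x
    proof (rule ccontr)
      assume "x \<noteq> c"
      then have "on_cycle E d" using ends_on_cyclesD[OF J dc dx] by blast
      then obtain p q where pq: "distinct [d, p, q]" "{d, p} \<in> E" "{p, q} \<in> E"
        unfolding on_cycle_def by auto
      have "p \<noteq> a" "p \<noteq> b" using pq(2) na[of d] nb[of d] dne by auto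
      moreover have "p \<noteq> c" using pq c_nbr[of q] by auto
      moreover have "q \<noteq> a" "q \<noteq> b" using pq(3) na[of p] nb[of p] calculation(1,2) by auto
      moreover have "q \<noteq> c" using pq nc[of p] by auto
      ultimately show False using p5freeD[OF pf ab'(2), of d p q] pq cd dne bc by auto
    qed
    \<comment> \<open>Max has joined two isolated edges into the path \<open>a b c d\<close>; Mini
      closes the 4-cycle.\<close>
    let ?W = "{a, b, c, d}" and ?F = "insert {a, d} ?E"
    have closed: "y \<in> ?W" if "{x, y} \<in> ?E" "x \<in> ?W" for x y
    proof (cases "{x, y} \<in> E")
      case True
      then show ?thesis using that(2) a_nbr b_nbr c_nbr d_nbr by blast
    qed (use that in auto)
    have F: "legal_position n ?F"
    proof (rule legal_inside_closed[OF E', of ?W])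
      show "y \<in> ?W" if "{x, y} \<in> ?E" "x \<in> ?W" for x y using closed that .
      show "card ?W \<le> 4" by (simp add: card_insert_if)
      show "d < n" using legal_positionD(4)[OF E cd] .
    qed (use lt dne in auto)
    have "ends_on_cycles ?F"
    proof (rule ends_on_cycles_local[OF J, of _ ?W])
      have e: "{a, b} \<in> ?F" "{b, c} \<in> ?F" "{c, d} \<in> ?F" "{d, a} \<in> ?F"
        using ab cd by (auto simp: insert_commute)
      have "distinct [a, b, c, d]" using dne bc ba(2) by auto
      then have "on_cycle ?F a" "on_cycle ?F b" "on_cycle ?F c" "on_cycle ?F d"
        using on_cycleI4[OF _ e] on_cycleI4[OF _ e(2-4) e(1)] on_cycleI4[OF _ e(3,4) e(1,2)]
          on_cycleI4[OF _ e(4) e(1-3)] by auto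
      then show "on_cycle ?F x" if "x \<in> ?W" for x using that by blast
    qed auto
    moreover have "{a, d} \<notin> ?E" using a_nbr[of d] dne bc by (auto simp: doubleton_eq_iff)
    ultimately show ?thesis using legal_move_iff[OF E'] F by blast
  qed
qed

text \<open>If the cycle condition fails after Max's move, it fails at an end of the new edge,
  because every other vertex keeps its old neighbours.\<close>

lemma reply_of_Mini:
  assumes E: "legal_position n E" and J: "ends_on_cycles E" and e: "e \<in> moves n E"
  shows "nearly_settled n (insert e E) \<or> (\<exists>e'\<in>moves n (insert e E). ends_on_cycles (insert e' (insert e E)))"
proof (cases "ends_on_cycles (insert e E)")
  case True
  have "legal_position n (insert e E)" using legal_move_iff[OF E] e by blast
  then show ?thesis using ends_on_cycles_wait True by blast
next
  case False
  obtain x y where xy: "e = {x, y}" "{x, y} \<notin> E" "legal_position n (insert {x, y} E)"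
    using move_obtain[OF E e] by metis
  obtain b s t where b: "{b, s} \<in> insert e E" "{b, t} \<in> insert e E" "s \<noteq> t" "\<not> on_cycle (insert e E) b"
    using False unfolding ends_on_cycles_def by blast
  have "\<not> on_cycle E b" using b(4) on_cycle_mono[of E b "insert e E"] by blast
  then have "\<not> ({b, s} \<in> E \<and> {b, t} \<in> E)" using ends_on_cyclesD[OF J _ _ b(3)] by blast
  then have "\<exists>a c. {b, c} = e \<and> {b, a} \<in> insert e E \<and> a \<noteq> c" using b(1-3) by blast
  then obtain a c where ac: "{b, c} = e" "{b, a} \<in> insert e E" "a \<noteq> c" by blast
  then have "{b, a} \<in> E" by (metis doubleton_eq_iff insert_iff)
  then show ?thesis
    using reply_close_cycle[OF E J, of b c a] ac b(4) xy by simp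
qed

lemma val_MaxP_ends_on_cycles:
  assumes "legal_position n E" "ends_on_cycles E"
  shows "val n MaxP E \<le> 3 * n"
  using assms
proof (induction "card ([{..<n}]\<^bsup>2\<^esup> - E)" arbitrary: E rule: less_induct)
  case less
  note E = less.prems(1) and J = less.prems(2)
  show ?case
  proof (rule val_MaxP_le)
    show "score n E \<le> 3 * n" using score_le[OF E ends_on_cycles_no_double_star[OF E J]] .
    fix e assume e: "e \<in> moves n E"
    have E1: "legal_position n (insert e E)" using legal_move_iff[OF E] e by blast
    show "val n MiniP (insert e E) \<le> 3 * n"
      using reply_of_Mini[OF E J e]
    proof
      assume "nearly_settled n (insert e E)"
      then show ?thesis using nearly_settled_val_le[OF E1] by blast
    next
      assume "\<exists>e'\<in>moves n (insert e E). ends_on_cycles (insert e' (insert e E))"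
      then obtain e' where e': "e' \<in> moves n (insert e E)" "ends_on_cycles (insert e' (insert e E))" by blast
      have "legal_position n (insert e' (insert e E))" using legal_move_iff[OF E1] e'(1) by blast
      then have "val n MaxP (insert e' (insert e E)) \<le> 3 * n"
        using less.hyps[OF _ _ e'(2)] card_unclaimed_less[OF e] card_unclaimed_less[OF e'(1)] by linarith
      then show ?thesis using val_MiniP_le[OF e'(1)] by blast
    qed
  qed
qed

section \<open>The bounds for the empty board and the asymptotics\<close>

lemma legal_position_empty: "legal_position n {}"
  by (simp add: legal_position_def p5free_def)

lemma val_empty_le: "val n p {} \<le> 3 * n"
proof -
  have J: "ends_on_cycles {}" by (simp add: ends_on_cycles_def)
  have Max: "val n MaxP {} \<le> 3 * n" using val_MaxP_ends_on_cycles[OF legal_position_empty J] .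
  have "val n MiniP {} \<le> 3 * n"
    using ends_on_cycles_wait[OF legal_position_empty J]
  proof
    assume "nearly_settled n {}"
    then show ?thesis using nearly_settled_val_le[OF legal_position_empty] by blast
  next
    assume "\<exists>e\<in>moves n {}. ends_on_cycles (insert e {})"
    then obtain e where e: "e \<in> moves n {}" "ends_on_cycles (insert e {})" by blast
    have "legal_position n (insert e {})" using legal_move_iff[OF legal_position_empty] e(1) by blast
    then show ?thesis using val_MiniP_le[OF e(1)] val_MaxP_ends_on_cycles e(2) by blast
  qed
  then show ?thesis using Max by (cases p) simp_all
qed

text \<open>Twice the target of at most \<open>3 * n\<close> copies is at most \<open>6 * n\<close>,
  hence the condition on \<open>k * k\<close>; the loss is
  \<open>15 * (6 * k + 8) + 6 = 90 * k + 126\<close>. If Max starts, a first isolated edge reduces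
  the game to Mini starting in a matched position.\<close>

lemma val_empty_ge:
  assumes "2 \<le> n" "6 * n \<le> k * k"
  shows "3 * n \<le> val n p {} + (90 * k + 126)"
proof -
  let ?c = "3 * n - (15 * (6 * k + 8) + 6)"
  have "matching {}" by (simp add: matching_def)
  then have K: "matched_position n {}"
    using matched_positionI[OF legal_position_empty, of "{}"] by (simp add: leaf_nbrs_small_def)
  have "k * k \<le> (2 + k) * (2 + k)" by (intro mult_le_mono) auto
  then have c: "2 * ?c \<le> (2 + k) * (2 + k)" using assms(2) by linarith
  have Mini: "?c \<le> val n MiniP E" if "matched_position n E" for E
    using val_MiniP_matched_position[OF that c order_refl] .
  have "2 \<le> card (isolated n {})" using assms(1) by (simp add: isolated_def)
  then obtain e where e: "e \<in> moves n {}" "matched_position n (insert e {})"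
    using matched_position_wait[OF K] by blast
  have "?c \<le> val n MaxP {}" using val_MaxP_ge[OF e(1) Mini[OF e(2)]] .
  then have "?c \<le> val n p {}" using Mini[OF K] by (cases p) simp_all
  then show ?thesis by (simp add: algebra_simps)
qed

lemma val_empty_asymp:
  "\<exists>\<epsilon> :: nat \<Rightarrow> real. \<epsilon> \<in> o(\<lambda>_. 1) \<and> (\<forall>\<^sub>F n in sequentially. real (val n p {}) = (3 + \<epsilon> n) * real n)"
proof (intro exI conjI)
  let ?e = "\<lambda>n. real (val n p {}) / real n - 3"
  have bound: "\<bar>?e n\<bar> \<le> 486 / sqrt (real n)" if n: "2 \<le> n" for n
  proof -
    define k where "k = nat \<lceil>sqrt (6 * real n)\<rceil>"
    have k: "sqrt (6 * real n) \<le> real k" "real k \<le> sqrt (6 * real n) + 1"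
      unfolding k_def by (simp_all add: real_nat_ceiling_ge of_nat_ceiling)
    have "6 * real n = sqrt (6 * real n) * sqrt (6 * real n)" by simp
    also have "\<dots> \<le> real k * real k" using k(1) by (intro mult_mono) auto
    finally have "real (6 * n) \<le> real (k * k)" by simp
    then have "6 * n \<le> k * k" by (simp only: of_nat_le_iff)
    from val_empty_ge[OF n this, of p]
    have "real (3 * n) \<le> real (val n p {} + (90 * k + 126))" by (simp only: of_nat_le_iff)
    then have lo: "3 * real n - real (val n p {}) \<le> 90 * sqrt (6 * real n) + 216" using k(2) by simp
    have hi: "real (val n p {}) \<le> 3 * real n" using val_empty_le[of n p] by linarith
    have "?e n = - ((3 * real n - real (val n p {})) / real n)" using n by (simp add: field_simps)
    moreover have "0 \<le> (3 * real n - real (val n p {})) / real n" using hi by simp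
    ultimately have "\<bar>?e n\<bar> = (3 * real n - real (val n p {})) / real n" by linarith
    \<comment> \<open>With \<open>k\<close> at most \<open>sqrt (6 * real n) + 1\<close> the loss is
      at most \<open>90 * sqrt (6 * real n) + 216\<close>. Estimating \<open>sqrt 6\<close> by 3 and
      1 by \<open>sqrt (real n)\<close> gives 270 + 216 = 486.\<close>
    also have "\<dots> \<le> (486 * sqrt (real n)) / real n"
    proof (intro divide_right_mono)
      have "sqrt 6 \<le> 3" by (rule real_le_lsqrt) simp_all
      then have "sqrt (6 * real n) \<le> 3 * sqrt (real n)" by (simp add: real_sqrt_mult mult_right_mono)
      moreover have "1 \<le> sqrt (real n)" using n by simp
      ultimately show "3 * real n - real (val n p {}) \<le> 486 * sqrt (real n)" using lo by linarith
    qed simp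
    also have "\<dots> = 486 / sqrt (real n)" using n by (simp add: field_simps)
    finally show ?thesis .
  qed
  have "(\<lambda>n. 486 / sqrt (real n)) \<longlonglongrightarrow> 0"
    by (intro tendsto_divide_0[OF tendsto_const] filterlim_at_top_imp_at_infinity
        filterlim_compose[OF sqrt_at_top filterlim_real_sequentially])
  then have "?e \<longlonglongrightarrow> 0"
  proof (rule tendsto_0_le[where K = 1])
    show "\<forall>\<^sub>F n in sequentially. norm (?e n) \<le> norm (486 / sqrt (real n)) * 1"
      using eventually_ge_at_top[of 2] by eventually_elim (use bound in simp)
  qed
  then show "?e \<in> o(\<lambda>_. 1)" by (intro smalloI_tendsto) auto
  show "\<forall>\<^sub>F n in sequentially. real (val n p {}) = (3 + ?e n) * real n"
    using eventually_gt_at_top[of 0] by eventually_elim simp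
qed

theorem theorem1p8:
  shows "\<forall>s\<in>{s1, s2}. \<exists>\<epsilon> :: nat \<Rightarrow> real. \<epsilon> \<in> o(\<lambda>_. 1) \<and>
           (\<forall>\<^sub>F n in sequentially. real (s n (path_graph 4) (path_graph 5)) = (3 + \<epsilon> n) * real n)"
  using val_empty_asymp[of MaxP] val_empty_asymp[of MiniP] by (auto simp: s1_def s2_def)

end
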